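(* Let $n\ge1$ and $s\in(0,1)$. There is a constant $C$, depending only on $s$ and $n$, such that for every $r>0$ and every nonnegative $f:\mathbb R^n\to\mathbb R$ with $\int_{\mathbb R^n}\frac{|f(x)|}{(1+|x|)^{n+2s}}\,dx<\infty$ and $(-\Delta)^s f=0$ in $B_r$, $$\sup_{B_{r/2}}f\le C\inf_{B_{r/2}}f.$$
   Context: $B_r\subset\mathbb R^n$ is the open ball of radius $r$ centered at the origin. The fractional Laplacian is $(-\Delta)^s f(x)=C_{n,s}\,\mathrm{PV}\int_{\mathbb R^n}\frac{f(x)-f(\xi)}{|x-\xi|^{n+2s}}\,d\xi$, with $C_{n,s}>0$ a normalization constant. For functions $f$ satisfying the integrability condition above it is understood in the distributional sense: $(-\Delta)^s f=0$ in an open set $U$ means $\int_{\mathbb R^n}f\,(-\Delta)^s\varphi\,dx=0$ for all $\varphi\in C_0^\infty(U)$. The supremum and infimum are the essential ones (equivalently, $f$ is identified in $B_r$ with its continuous representative). *)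

theory Defs
  imports "HOL-Probability.Essential_Supremum"
begin

fun C_k :: "nat \<Rightarrow> ('a::euclidean_space \<Rightarrow> real) \<Rightarrow> bool" where
  "C_k 0 f \<longleftrightarrow> continuous_on UNIV f"
| "C_k (Suc k) f \<longleftrightarrow>
     f differentiable_on UNIV \<and> (\<forall>v. C_k k (\<lambda>x. frechet_derivative f (at x) v))"

definition test_functions :: "'a::euclidean_space set \<Rightarrow> ('a \<Rightarrow> real) set" where
  "test_functions U =
     {\<phi>. (\<forall>k. C_k k \<phi>) \<and> compact (closure {x. \<phi> x \<noteq> 0}) \<and> closure {x. \<phi> x \<noteq> 0} \<subseteq> U}"

text \<open>The usual normalization \<open>4\<^sup>s \<Gamma>(n/2+s) / (\<pi>\<^sup>n\<^sup>/\<^sup>2 |\<Gamma>(-s)|)\<close>, for which the operator has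
  Fourier symbol \<open>|\<xi>|\<^sup>2\<^sup>s\<close>; here \<open>|\<Gamma>(-s)|\<close> is written as \<open>\<Gamma>(1-s)/s\<close>, so that positivity for
  \<open>0 < s < 1\<close> is visible.\<close>
definition frac_laplacian_const :: "nat \<Rightarrow> real \<Rightarrow> real" where
  "frac_laplacian_const n s =
     4 powr s * s * Gamma (real n / 2 + s) / (pi powr (real n / 2) * Gamma (1 - s))"

definition frac_laplacian :: "real \<Rightarrow> ('a::euclidean_space \<Rightarrow> real) \<Rightarrow> 'a \<Rightarrow> real" where
  "frac_laplacian s f x =
     frac_laplacian_const DIM('a) s *
     Lim (at_right 0) (\<lambda>\<epsilon>. LINT \<xi>:- ball x \<epsilon>|lebesgue.
       (f x - f \<xi>) / norm (x - \<xi>) powr (real DIM('a) + 2 * s))"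

definition weighted_integrable :: "real \<Rightarrow> ('a::euclidean_space \<Rightarrow> real) \<Rightarrow> bool" where
  "weighted_integrable s f \<longleftrightarrow>
     f \<in> borel_measurable lebesgue \<and>
     integrable lebesgue (\<lambda>x. \<bar>f x\<bar> / (1 + norm x) powr (real DIM('a) + 2 * s))"

text \<open>The distributional equation \<open>(-\<Delta>)\<^sup>s f = 0\<close> in \<open>U\<close>, meant for \<open>f\<close> with
  \<open>weighted_integrable s f\<close>: then the integrand below is integrable, because
  \<open>frac_laplacian s \<phi>\<close> is bounded by a multiple of \<open>(1 + |x|)\<^sup>-\<^sup>n\<^sup>-\<^sup>2\<^sup>s\<close>.\<close>
definition frac_laplacian_zero_in ::
    "real \<Rightarrow> ('a::euclidean_space \<Rightarrow> real) \<Rightarrow> 'a set \<Rightarrow> bool" where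
  "frac_laplacian_zero_in s f U \<longleftrightarrow>
     (\<forall>\<phi> \<in> test_functions U. (LINT x|lebesgue. f x * frac_laplacian s \<phi> x) = 0)"

definition essinf :: "'a measure \<Rightarrow> ('a \<Rightarrow> ereal) \<Rightarrow> ereal" where
  "essinf M f = - esssup M (\<lambda>x. - f x)"

end

theory Submission
  imports Defs
begin

text \<open>
  Only test functions built from one radially decreasing bump \<open>\<psi>\<close> on the unit ball are used. Put
  \<open>h = (-\<Delta>)\<^sup>s \<psi>\<close> (without the normalization) and \<open>n\<close> for the dimension. The flux
  \<open>\<Phi>(\<rho>)\<close>, the integral of \<open>h\<close> over the ball of radius \<open>\<rho>\<close>, equals the integral of
  \<open>(\<psi>(x) - \<psi>(z)) |x-z|\<^sup>-\<^sup>n\<^sup>-\<^sup>2\<^sup>s\<close> over \<open>|x| < \<rho> \<le> |z|\<close>, because the part with both points inside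
  cancels by antisymmetry; since \<open>\<psi>\<close> is radially decreasing it is positive, and
  \<open>K(x) = \<Phi>(|x|) / |x|\<^sup>n\<close> is comparable to the weight \<open>(1+|x|)\<^sup>-\<^sup>n\<^sup>-\<^sup>2\<^sup>s\<close>.

  The derivative of \<open>\<mu>\<^sup>n K(\<mu>x)\<close> in \<open>\<mu>\<close> is a multiple of \<open>\<mu>\<^sup>n\<^sup>-\<^sup>1 h(\<mu>x)\<close>, as \<open>h\<close> is radial. Hence testing
  the equation with \<open>\<psi>(\<mu>(y-a))\<close> for all \<open>\<mu> \<ge> 4/r\<close> shows that the average
  of \<open>f\<close> against \<open>\<mu>\<^sup>n K(\<mu>(y-a))\<close> does not depend on \<open>\<mu>\<close>. As \<open>\<mu> \<rightarrow> \<infinity>\<close> it tends to a multiple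
  of \<open>f(a)\<close>, while at \<open>\<mu> = 4/r\<close> it is comparable, uniformly for \<open>|a| < r/2\<close>, to one and the same
  weighted integral of \<open>f\<close>.
\<close>

section \<open>Lebesgue measure: scaling, isometries, polar coordinates\<close>

text \<open>The averaging kernel must be nonnegative and bounded above and below by the weight,
  because \<open>f\<close> is controlled only through its weighted integral. The function h changes
  sign, so it cannot serve. Its flux can: it is of order \<rho>^n for small \<rho> and of order
  \<rho>^(-2s) for large \<rho>, where only the bump interacts with the exterior. Division by |x|^n
  turns both into the order of the weight.

  Since \<open>f\<close> is only measurable, the limit of large scale is not taken at a point. It is
  taken after integrating the centre a over a box, and almost everywhere values are recovered by
  Lebesgue differentiation. The derivative in the scale likewise enters only in integrated form,
  over spherical shells.

  The scale 4/r does two jobs. The bump is supported in a ball of radius at most r/4 about a, hence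
  inside the ball where the equation holds. After scaling, the shift by a has length at most 2, so
  the weights centred at a and at 0 differ by a factor of at most 3^(n+2s). As this comparison is
  made in the scaled variable, the final constant is independent of r.\<close>

lemma lborel_integral_affine:
  fixes f :: "'a::euclidean_space \<Rightarrow> real"
  assumes [measurable]: "f \<in> borel_measurable borel" and c: "c \<noteq> 0"
  shows "(\<integral>x. f x \<partial>lborel) = \<bar>c\<bar> ^ DIM('a) * (\<integral>x. f (t + c *\<^sub>R x) \<partial>lborel)"
  by (subst lborel_affine[OF c, of t]) (simp add: integral_density integral_distr)

lemma lborel_integrable_affine:
  fixes f :: "'a::euclidean_space \<Rightarrow> real"
  assumes [measurable]: "f \<in> borel_measurable borel" and c: "c \<noteq> 0" and "integrable lborel f"
  shows "integrable lborel (\<lambda>x. f (t + c *\<^sub>R x))"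
proof -
  have "integrable (density (distr lborel borel (\<lambda>x. t + c *\<^sub>R x)) (\<lambda>_. \<bar>c\<bar> ^ DIM('a))) f"
    using assms(3) lborel_affine[OF c, of t] by simp
  then show ?thesis
    using c by (simp add: integrable_density integrable_distr_eq)
qed

lemma integrable_indicator_ball:
  "integrable lborel (indicator (ball c r) :: 'a::euclidean_space \<Rightarrow> real)"
  using emeasure_lborel_ball_finite[of c r] by (simp add: integrable_indicator_iff)

lemma lborel_distr_minus:
  "distr lborel borel (\<lambda>y. c - y) = (lborel :: 'a::euclidean_space measure)"
  using lborel_affine[of "-1" c] by (simp add: density_1)

text \<open>Uniqueness of translation-invariant measures makes the image of Lebesgue measure a
  multiple of it, and the unit ball, which \<open>T\<close> preserves, shows that the factor is 1.
  This is needed for the radial symmetry of \<open>bump_lap\<close>.\<close>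

lemma lborel_distr_orthogonal:
  fixes T :: "'a::euclidean_space \<Rightarrow> 'a"
  assumes T: "orthogonal_transformation T"
  shows "distr lborel borel T = lborel"
proof (rule measure_eqI)
  have [measurable]: "T \<in> borel_measurable borel"
    using T linear_continuous_on linear_conv_bounded_linear
    by (metis borel_measurable_continuous_onI orthogonal_transformation_def)
  have surj: "surj T" using T by (rule orthogonal_transformation_surj)
  have lin: "linear T" using T by (simp add: orthogonal_transformation_def)
  have vim: "(\<integral>\<^sup>+x. indicator A (T x) \<partial>lborel) = emeasure lborel (T -` A)"
    if "A \<in> sets borel" for A
  proof -
    have "(\<lambda>x. indicator A (T x) :: ennreal) = indicator (T -` A)"
      by (auto simp: indicator_def)
    then show ?thesis
      using measurable_sets_borel[of T borel A] that by simp
  qed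
  \<comment> \<open>uniqueness of translation-invariant measures: integrate \<open>1\<^sub>A(Tx) 1\<^sub>B(Tx + y)\<close> in both orders\<close>
  have eq: "emeasure lborel (T -` A) * emeasure lborel B = emeasure lborel (T -` B) * emeasure lborel A"
    if [measurable]: "A \<in> sets borel" "B \<in> sets borel" for A B :: "'a set"
  proof -
    have "emeasure lborel (T -` A) * emeasure lborel B
        = (\<integral>\<^sup>+x. indicator A (T x) * (\<integral>\<^sup>+y. indicator B y \<partial>lborel) \<partial>lborel)"
      by (simp add: nn_integral_multc vim)
    also have "\<dots> = (\<integral>\<^sup>+x. indicator A (T x) * (\<integral>\<^sup>+y. indicator B (T x + y) \<partial>lborel) \<partial>lborel)"
    proof -
      have "(\<integral>\<^sup>+y. indicator B y \<partial>lborel) = (\<integral>\<^sup>+y. indicator B (c + y) \<partial>lborel)" for c :: 'a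
        by (subst lborel_distr_plus[of c, symmetric], subst nn_integral_distr) auto
      then show ?thesis by simp
    qed
    also have "\<dots> = (\<integral>\<^sup>+x. (\<integral>\<^sup>+y. indicator A (T x) * indicator B (T x + y) \<partial>lborel) \<partial>lborel)"
      by (simp add: nn_integral_cmult)
    also have "\<dots> = (\<integral>\<^sup>+y. (\<integral>\<^sup>+x. indicator A (T x) * indicator B (T x + y) \<partial>lborel) \<partial>lborel)"
      by (subst lborel_pair.Fubini') auto
    also have "\<dots> = (\<integral>\<^sup>+y. (\<integral>\<^sup>+x. indicator A (T x - y) * indicator B (T x) \<partial>lborel) \<partial>lborel)"
    proof (rule nn_integral_cong)
      fix y :: 'a
      obtain z where z: "T z = y" using surj by (metis surjD)
      show "(\<integral>\<^sup>+x. indicator A (T x) * indicator B (T x + y) \<partial>lborel)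
          = (\<integral>\<^sup>+x. indicator A (T x - y) * indicator B (T x) \<partial>lborel)"
        by (subst (2) lborel_distr_plus[of z, symmetric])
          (simp add: nn_integral_distr linear_add[OF lin] z algebra_simps)
    qed
    also have "\<dots> = (\<integral>\<^sup>+x. (\<integral>\<^sup>+y. indicator A (T x - y) * indicator B (T x) \<partial>lborel) \<partial>lborel)"
      by (subst lborel_pair.Fubini') auto
    also have "\<dots> = (\<integral>\<^sup>+x. (\<integral>\<^sup>+y. indicator A (T x - y) \<partial>lborel) * indicator B (T x) \<partial>lborel)"
      by (simp add: nn_integral_multc)
    also have "\<dots> = (\<integral>\<^sup>+x. (\<integral>\<^sup>+y. indicator A y \<partial>lborel) * indicator B (T x) \<partial>lborel)"
    proof -
      have "(\<integral>\<^sup>+y. indicator A y \<partial>lborel) = (\<integral>\<^sup>+y. indicator A (c - y) \<partial>lborel)" for c :: 'a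
        by (subst lborel_distr_minus[of c, symmetric], subst nn_integral_distr) auto
      then show ?thesis by simp
    qed
    also have "\<dots> = emeasure lborel (T -` B) * emeasure lborel A"
      by (simp add: nn_integral_cmult vim mult.commute)
    finally show ?thesis .
  qed
  fix A assume "A \<in> sets (distr lborel borel T)"
  then have [measurable]: "A \<in> sets borel" by simp
  have "norm (T x) = norm x" for x
    using T by (simp add: orthogonal_transformation)
  then have B: "T -` ball 0 1 = ball 0 1" by auto
  have fin: "emeasure lborel (ball (0::'a) 1) \<noteq> 0" "emeasure lborel (ball (0::'a) 1) \<noteq> \<infinity>"
    using less_imp_neq[OF unit_ball_vol_pos[of "real DIM('a)"]] by (auto simp: emeasure_ball)
  have eqA: "emeasure lborel (ball (0::'a) 1) * emeasure lborel (T -` A)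
      = emeasure lborel (ball (0::'a) 1) * emeasure lborel A"
    using eq[of A "ball 0 1"] by (simp add: B mult.commute)
  show "emeasure (distr lborel borel T) A = emeasure lborel A"
    using fin eqA by (simp add: emeasure_distr ennreal_mult_cancel_left)
qed simp

text \<open>Polar coordinates for radial functions, without a surface measure: the volumes of balls
  determine the image measure on half-lines, and half-lines generate the Borel sets.\<close>

lemma distr_norm_lborel:
  "distr lborel borel (norm :: 'a::euclidean_space \<Rightarrow> real) =
    density lborel (\<lambda>t. ennreal (indicator {0..} t * (DIM('a) * unit_ball_vol DIM('a) * t ^ (DIM('a) - 1))))"
    (is "?L = ?R")
proof (rule measure_eqI_generator_eq[where A="\<lambda>n. {..real n}"])
  let ?n = "DIM('a)" and ?\<omega> = "unit_ball_vol DIM('a)"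
  have *: "emeasure ?L {..a} = ennreal (?\<omega> * (if a \<ge> 0 then a ^ ?n else 0))" for a
  proof (cases "a \<ge> 0")
    case True
    have "emeasure ?L {..a} = emeasure lborel (cball (0::'a) a)"
      by (subst emeasure_distr) (auto intro!: arg_cong[where f="emeasure lborel"])
    then show ?thesis using True by (simp add: emeasure_cball)
  next
    case False
    then have "norm -` {..a} = ({} :: 'a set)"
      by (auto simp: not_le) (meson norm_not_less_zero order.strict_trans1)
    then show ?thesis using False by (simp add: emeasure_distr)
  qed
  have "emeasure ?R {..a} = ennreal (?\<omega> * (if a \<ge> 0 then a ^ ?n else 0))" for a
  proof (cases "a \<ge> 0")
    case True
    have "emeasure ?R {..a} = (\<integral>\<^sup>+t. ennreal (?n * ?\<omega> * t ^ (?n - 1)) * indicator {0..a} t \<partial>lborel)"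
      by (subst emeasure_density) (auto intro!: nn_integral_cong split: split_indicator)
    also have "\<dots> = ?\<omega> * a ^ ?n - ?\<omega> * 0 ^ ?n"
      by (rule nn_integral_FTC_Icc) (use True in \<open>auto intro!: derivative_eq_intros\<close>)
    finally show ?thesis using True by simp
  next
    case False
    then have "emeasure ?R {..a} = 0"
      by (simp add: emeasure_density nn_integral_0_iff_AE split: split_indicator)
    then show ?thesis using False by simp
  qed
  with * show "emeasure ?L X = emeasure ?R X" if "X \<in> range (\<lambda>a. {..a})" for X
    using that by auto
  show "Int_stable (range (\<lambda>a::real. {..a}))"
    by (auto simp: Int_stable_def)
  show "sets ?L = sigma_sets UNIV (range (\<lambda>a. {..a}))" "sets ?R = sigma_sets UNIV (range (\<lambda>a. {..a}))"
    by (auto simp: borel_eq_atMost)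
  show "range (\<lambda>n. {..real n}) \<subseteq> range (\<lambda>a. {..a})" by auto
  show "(\<Union>i. {..real i}) = UNIV"
    by (auto simp: real_arch_simple)
  show "emeasure ?L {..real i} \<noteq> \<infinity>" for i
    unfolding * by simp
qed simp

lemma integral_radial:
  fixes g :: "real \<Rightarrow> real"
  assumes [measurable]: "g \<in> borel_measurable borel"
  shows "(\<integral>x. g (norm (x::'a::euclidean_space)) \<partial>lborel)
    = real DIM('a) * unit_ball_vol DIM('a) * (\<integral>t. indicator {0..} t * t ^ (DIM('a) - 1) * g t \<partial>lborel)"
proof -
  have "(\<integral>x. g (norm (x::'a)) \<partial>lborel) = (\<integral>t. g t \<partial>distr lborel borel (norm :: 'a \<Rightarrow> real))"
    by (simp add: integral_distr)
  also have "\<dots> = (\<integral>t. (real DIM('a) * unit_ball_vol DIM('a)) * (indicator {0..} t * t ^ (DIM('a) - 1) * g t) \<partial>lborel)"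
    unfolding distr_norm_lborel
    by (subst integral_density) (auto intro!: AE_I2 Bochner_Integration.integral_cong split: split_indicator
        simp flip: integral_mult_right_zero)
  finally show ?thesis by simp
qed

lemma nn_integral_radial:
  assumes [measurable]: "g \<in> borel_measurable borel"
  shows "(\<integral>\<^sup>+x. g (norm (x::'a::euclidean_space)) \<partial>lborel)
    = (\<integral>\<^sup>+t. ennreal (indicator {0..} t * (DIM('a) * unit_ball_vol DIM('a) * t ^ (DIM('a) - 1))) * g t \<partial>lborel)"
proof -
  have "(\<integral>\<^sup>+x. g (norm (x::'a)) \<partial>lborel) = (\<integral>\<^sup>+t. g t \<partial>distr lborel borel (norm :: 'a \<Rightarrow> real))"
    by (simp add: nn_integral_distr)
  then show ?thesis
    unfolding distr_norm_lborel by (simp add: nn_integral_density)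
qed

text \<open>For distinct points the reflection in the hyperplane orthogonal to \<open>x - y\<close>
  exchanges them, because their norms agree.\<close>

lemma exists_orthogonal_transformation:
  fixes x y :: "'a::euclidean_space"
  assumes "norm x = norm y"
  obtains T where "orthogonal_transformation T" "T x = y"
proof (cases "x = y")
  case True
  then show ?thesis using that[of id] by (simp add: orthogonal_transformation_def linear_id)
next
  case False
  define u where "u = x - y"
  define T where "T = (\<lambda>v. v - (2 * (v \<bullet> u) / (u \<bullet> u)) *\<^sub>R u)"
  have u: "u \<bullet> u \<noteq> 0" using False by (simp add: u_def)
  have "linear T" unfolding T_def
    by (rule linearI) (simp_all add: algebra_simps inner_add_left add_divide_distrib scaleR_add_left)
  moreover have "T v \<bullet> T w = v \<bullet> w" for v w
    using u unfolding T_def by (simp add: inner_diff_left inner_diff_right inner_commute field_simps)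
  moreover have "T x = y"
  proof -
    have "2 * (x \<bullet> u) = u \<bullet> u"
      using assms by (simp add: u_def inner_diff_left inner_diff_right inner_commute norm_eq)
    then show ?thesis using u by (simp add: T_def) (simp add: u_def)
  qed
  ultimately show ?thesis using that[of T] by (auto simp: orthogonal_transformation_def)
qed

section \<open>A smooth radially decreasing bump\<close>

text \<open>The power of t in the denominator makes the family closed under differentiation up to
  linear combinations, so smoothness of all members follows by one induction.\<close>

definition flat_exp :: "nat \<Rightarrow> real \<Rightarrow> real" where
  "flat_exp m t = (if t \<le> 0 then 0 else exp (- 1 / t) / t ^ m)"

lemma flat_exp_nonneg: "0 \<le> flat_exp m t"
  by (simp add: flat_exp_def)

text \<open>With u = 1/t this is u^m / m! \<le> exp u, a single term of the exponential series.
  These bounds supply all explicit derivative constants below.\<close>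

lemma flat_exp_le: "flat_exp m t \<le> fact m"
proof (cases "t \<le> 0")
  case False
  define u where "u = 1 / t"
  have u: "u > 0" using False by (simp add: u_def)
  have "u ^ m / fact m \<le> exp u"
  proof -
    have "(\<Sum>k\<in>{m}. inverse (fact k) *\<^sub>R u ^ k) \<le> (\<Sum>k. inverse (fact k) *\<^sub>R u ^ k)"
      by (rule sum_le_suminf[OF summable_exp_generic]) (use u in auto)
    then show ?thesis by (simp add: exp_def field_simps)
  qed
  then have "u ^ m / exp u \<le> fact m" by (simp add: field_simps)
  moreover have "flat_exp m t = u ^ m / exp u"
    using False by (simp add: flat_exp_def u_def exp_minus field_simps)
  ultimately show ?thesis by simp
qed (simp add: flat_exp_def)

lemma flat_exp_mult: "t * flat_exp (Suc m) t = flat_exp m t"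
  by (simp add: flat_exp_def)

lemma DERIV_flat_exp:
  "(flat_exp m has_real_derivative flat_exp (Suc (Suc m)) t - m * flat_exp (Suc m) t) (at t)"
proof (cases t "0::real" rule: linorder_cases)
  case less
  have "((\<lambda>_. 0) has_real_derivative 0) (at t)" by simp
  then have "(flat_exp m has_real_derivative 0) (at t)"
    by (rule has_field_derivative_transform_within[of _ _ _ _ "-t"])
      (use less in \<open>auto simp: flat_exp_def dist_real_def\<close>)
  then show ?thesis using less by (simp add: flat_exp_def)
next
  case greater
  have "((\<lambda>t. exp (- 1 / t) / t ^ m) has_real_derivative
      flat_exp (Suc (Suc m)) t - m * flat_exp (Suc m) t) (at t)"
  proof (rule DERIV_cong)
    show "((\<lambda>t. exp (- 1 / t) / t ^ m) has_real_derivative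
        (exp (- 1 / t) * (1 / (t * t)) * t ^ m - exp (- 1 / t) * (m * t ^ (m - 1))) / (t ^ m * t ^ m)) (at t)"
    proof (rule DERIV_divide)
      have "((\<lambda>t. - 1 / t) has_real_derivative 1 / (t * t)) (at t)"
        using greater by (auto intro!: derivative_eq_intros)
      then show "((\<lambda>t. exp (- 1 / t)) has_real_derivative exp (- 1 / t) * (1 / (t * t))) (at t)"
        by (rule DERIV_chain2[OF DERIV_exp])
      show "((\<lambda>t. t ^ m) has_real_derivative m * t ^ (m - 1)) (at t)"
        using DERIV_pow[of m t] by simp
      show "t ^ m \<noteq> 0" using greater by simp
    qed
    show "(exp (- 1 / t) * (1 / (t * t)) * t ^ m - exp (- 1 / t) * (m * t ^ (m - 1))) / (t ^ m * t ^ m)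
        = flat_exp (Suc (Suc m)) t - m * flat_exp (Suc m) t"
      using greater by (cases m) (auto simp: flat_exp_def field_simps)
  qed
  then show ?thesis
    by (rule has_field_derivative_transform_within[of _ _ _ _ t])
      (use greater in \<open>auto simp: flat_exp_def dist_real_def\<close>)
next
  case equal
  have "(\<lambda>h. flat_exp m h / h) \<midarrow>0\<rightarrow> 0"
  proof (rule Lim_null_comparison)
    show "\<forall>\<^sub>F h in at 0. norm (flat_exp m h / h) \<le> \<bar>h\<bar> * fact (Suc (Suc m))"
    proof (rule always_eventually, rule allI)
      fix h :: real
      \<comment> \<open>Two factors of \<open>h\<close> are extracted: one cancels the denominator
        of the difference quotient, the other makes it tend to 0.\<close>
      have "flat_exp m h = h * h * flat_exp (Suc (Suc m)) h"
        using flat_exp_mult[of h m] flat_exp_mult[of h "Suc m"] by (simp add: mult.assoc)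
      then have "norm (flat_exp m h / h) = \<bar>h\<bar> * flat_exp (Suc (Suc m)) h"
        using flat_exp_nonneg by (simp add: abs_mult)
      then show "norm (flat_exp m h / h) \<le> \<bar>h\<bar> * fact (Suc (Suc m))"
        using flat_exp_le[of "Suc (Suc m)" h] by (simp add: mult_left_mono del: fact_Suc)
    qed
    show "(\<lambda>h. \<bar>h\<bar> * fact (Suc (Suc m))) \<midarrow>0\<rightarrow> (0::real)"
      by (rule tendsto_eq_intros tendsto_rabs | simp)+
  qed
  then show ?thesis
    using equal by (simp add: DERIV_def flat_exp_def)
qed

section \<open>Calculus of iterated Frechet derivatives and smoothness of the bump\<close>

lemma C_k_SucI:
  assumes "\<And>x. (f has_derivative f' x) (at x)" and "\<And>v. C_k k (\<lambda>x. f' x v)"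
  shows "C_k (Suc k) f"
proof -
  have "frechet_derivative f (at x) = f' x" for x
    using frechet_derivative_at[OF assms(1)] by simp
  moreover have "f differentiable_on UNIV"
    using assms(1) by (auto simp: differentiable_on_def differentiable_def)
  ultimately show ?thesis using assms(2) by simp
qed

lemma C_k_SucD:
  assumes "C_k (Suc k) f"
  shows "(f has_derivative frechet_derivative f (at x)) (at x)"
    and "C_k k (\<lambda>x. frechet_derivative f (at x) v)"
  using assms by (auto simp: differentiable_on_def frechet_derivative_works)

text \<open>In the product rule the undifferentiated factor must be used at one order less than it
  is given.\<close>

lemma C_k_Suc_imp: "C_k (Suc k) f \<Longrightarrow> C_k k f"
proof (induction k arbitrary: f)
  case 0
  then show ?case by (simp add: differentiable_imp_continuous_on)
next
  case (Suc k)
  show ?case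
    by (rule C_k_SucI[OF C_k_SucD(1)[OF Suc.prems]]) (intro Suc.IH C_k_SucD(2)[OF Suc.prems])
qed

lemma C_k_const: "C_k k (\<lambda>_. c)"
proof (induction k arbitrary: c)
  case (Suc k)
  show ?case by (rule C_k_SucI[where f'="\<lambda>_ _. 0"]) (auto intro: Suc)
qed simp

lemma C_k_add: "C_k k f \<Longrightarrow> C_k k g \<Longrightarrow> C_k k (\<lambda>x. f x + g x)"
proof (induction k arbitrary: f g)
  case (Suc k)
  note f = C_k_SucD[OF Suc.prems(1)] and g = C_k_SucD[OF Suc.prems(2)]
  show ?case
    by (rule C_k_SucI[OF has_derivative_add[OF f(1) g(1)]]) (intro Suc.IH f g)
qed (simp add: continuous_on_add)

lemma C_k_mult: "C_k k f \<Longrightarrow> C_k k g \<Longrightarrow> C_k k (\<lambda>x. f x * g x)"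
proof (induction k arbitrary: f g)
  case (Suc k)
  note f = C_k_SucD[OF Suc.prems(1)] and g = C_k_SucD[OF Suc.prems(2)]
  show ?case
    by (rule C_k_SucI[OF has_derivative_mult[OF f(1) g(1)]])
      (intro C_k_add Suc.IH f g Suc.prems[THEN C_k_Suc_imp])
qed (simp add: continuous_on_mult)

text \<open>The induction on \<open>k\<close> keeps \<open>m\<close> arbitrary, as each derivative
  produces the members \<open>m + 1\<close> and \<open>m + 2\<close> of the family.\<close>

lemma C_k_flat_exp:
  assumes "\<And>k. C_k k q"
  shows "C_k k (\<lambda>x. flat_exp m (q x))"
proof (induction k arbitrary: m)
  case 0
  have "continuous_on UNIV (flat_exp m)"
    using DERIV_flat_exp by (meson DERIV_isCont continuous_at_imp_continuous_on)
  then have "continuous_on UNIV (flat_exp m \<circ> q)"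
    using assms[of 0] continuous_on_subset by (intro continuous_on_compose) auto
  then show ?case by (simp add: o_def)
next
  case (Suc k)
  note q = C_k_SucD[OF assms]
  have "((\<lambda>x. flat_exp m (q x)) has_derivative
      (\<lambda>v. frechet_derivative q (at x) v * (flat_exp (Suc (Suc m)) (q x) + (- real m) * flat_exp (Suc m) (q x)))) (at x)" for x
    using DERIV_compose_FDERIV[OF DERIV_flat_exp q(1)] by simp
  then show ?case
    by (rule C_k_SucI) (intro C_k_mult C_k_add C_k_const Suc.IH q)
qed

lemma C_k_quadratic:
  fixes a :: "'a::euclidean_space"
  shows "C_k k (\<lambda>y. c + d * ((y - a) \<bullet> (y - a)))"
proof -
  have lin: "C_k k (\<lambda>y. (y - a) \<bullet> v)" for k and v :: 'a
  proof (cases k)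
    case (Suc j)
    have "((\<lambda>y. (y - a) \<bullet> v) has_derivative (\<lambda>h. h \<bullet> v)) (at x)" for x
      by (auto intro!: derivative_eq_intros)
    then show ?thesis unfolding Suc by (rule C_k_SucI) (rule C_k_const)
  qed (auto intro!: continuous_intros)
  show ?thesis
  proof (cases k)
    case (Suc j)
    have "((\<lambda>y. c + d * ((y - a) \<bullet> (y - a))) has_derivative (\<lambda>v. 2 * d * ((x - a) \<bullet> v))) (at x)" for x
      by (auto intro!: derivative_eq_intros simp: inner_commute)
    then show ?thesis unfolding Suc by (rule C_k_SucI) (intro C_k_mult C_k_const lin)
  qed (auto intro!: continuous_intros)
qed

text \<open>The unnormalized mollifier exp(-1/(1-|x|^2)) of the unit ball. It is written through the
  inner product because the norm itself is not differentiable at 0.\<close>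

definition std_bump :: "'a::euclidean_space \<Rightarrow> real" where
  "std_bump x = flat_exp 0 (1 - x \<bullet> x)"

lemma std_bump_bounds: "0 \<le> std_bump x" "std_bump x \<le> 1"
  using flat_exp_le[of 0] by (simp_all add: std_bump_def flat_exp_nonneg)

lemma std_bump_eq_0: "1 \<le> norm x \<Longrightarrow> std_bump x = 0"
  using power_mono[of 1 "norm x" 2] by (simp add: std_bump_def flat_exp_def power2_norm_eq_inner)

lemma std_bump_eq_0_iff: "std_bump x = 0 \<longleftrightarrow> 1 \<le> norm x"
  using abs_square_less_1[of "norm x"]
  by (auto simp: std_bump_def flat_exp_def power2_norm_eq_inner[symmetric] not_le)

lemma std_bump_norm_mono: "norm x \<le> norm y \<Longrightarrow> std_bump y \<le> std_bump x"
proof -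
  assume "norm x \<le> norm y"
  then have *: "x \<bullet> x \<le> y \<bullet> y" by (simp add: norm_le)
  show ?thesis
  proof (cases "y \<bullet> y < 1")
    case True
    with * show ?thesis by (simp add: std_bump_def flat_exp_def frac_le)
  next
    case False
    then have "std_bump y = 0" by (simp add: std_bump_def flat_exp_def)
    then show ?thesis using std_bump_bounds(1)[of x] by simp
  qed
qed

lemma borel_measurable_std_bump [measurable]: "std_bump \<in> borel_measurable borel"
  unfolding std_bump_def flat_exp_def by measurable

lemma std_bump_test_function:
  fixes a :: "'a::euclidean_space"
  assumes "0 < \<mu>" "cball a (1 / \<mu>) \<subseteq> U"
  shows "(\<lambda>y. std_bump (\<mu> *\<^sub>R (y - a))) \<in> test_functions U"
proof -
  have "C_k k (\<lambda>y. flat_exp 0 (1 + (- (\<mu>\<^sup>2)) * ((y - a) \<bullet> (y - a))))" for k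
    by (intro C_k_flat_exp C_k_quadratic)
  then have "C_k k (\<lambda>y. std_bump (\<mu> *\<^sub>R (y - a)))" for k
    by (simp add: std_bump_def power2_eq_square mult.assoc)
  moreover have "{y. std_bump (\<mu> *\<^sub>R (y - a)) \<noteq> 0} = ball a (1 / \<mu>)"
    using assms(1)
    by (auto simp: std_bump_eq_0_iff dist_norm norm_minus_commute pos_less_divide_eq mult.commute not_le
        simp flip: scaleR_diff_right)
  ultimately show ?thesis
    using assms by (simp add: test_functions_def)
qed

text \<open>Symmetrizing in \<open>y\<close> replaces the principal value by an absolutely convergent integral.\<close>
definition second_diff :: "'a::euclidean_space \<Rightarrow> 'a \<Rightarrow> real" where
  "second_diff x y = 2 * std_bump x - std_bump (x + y) - std_bump (x - y)"

lemma borel_measurable_second_diff [measurable]: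
  "(\<lambda>(x, y). second_diff x y) \<in> borel_measurable (borel \<Otimes>\<^sub>M borel)"
  unfolding second_diff_def by measurable

text \<open>The derivative of \<open>flat_exp 0\<close> is \<open>flat_exp 2\<close>, which has
  Lipschitz constant 36 = 4! + 2 * 3!. Hence the derivative in t of the symmetric sum at a + t and a
  - t is at most 36 * 2|t|, and the mean value inequality on |t| \<le> |b| gives 72 b^2.\<close>

lemma flat_exp_second_diff:
  "\<bar>flat_exp 0 (a + b) + flat_exp 0 (a - b) - 2 * flat_exp 0 a\<bar> \<le> 72 * b\<^sup>2"
proof -
  have lip: "\<bar>flat_exp 2 u - flat_exp 2 v\<bar> \<le> 36 * \<bar>u - v\<bar>" for u v
  proof -
    have "norm (flat_exp 2 u - flat_exp 2 v) \<le> 36 * norm (u - v)"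
    proof (rule field_differentiable_bound[where S=UNIV and f'="\<lambda>t. flat_exp 4 t - 2 * flat_exp 3 t"])
      fix t
      show "(flat_exp 2 has_field_derivative flat_exp 4 t - 2 * flat_exp 3 t) (at t within UNIV)"
        using DERIV_flat_exp[of 2 t] by (simp add: numeral_eq_Suc)
      show "norm (flat_exp 4 t - 2 * flat_exp 3 t) \<le> 36"
        using flat_exp_nonneg[of 4 t] flat_exp_nonneg[of 3 t] flat_exp_le[of 4 t] flat_exp_le[of 3 t]
        by (auto simp: fact_numeral abs_le_iff)
    qed auto
    then show ?thesis by simp
  qed
  define g where "g t = flat_exp 0 (a + t) + flat_exp 0 (a - t)" for t
  have g': "(g has_field_derivative flat_exp 2 (a + t) - flat_exp 2 (a - t)) (at t)" for t
  proof -
    have d: "(flat_exp 0 has_field_derivative flat_exp 2 u) (at u)" for u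
      using DERIV_flat_exp[of 0 u] by (simp add: numeral_eq_Suc)
    have "((\<lambda>t. flat_exp 0 (a + t)) has_field_derivative flat_exp 2 (a + t) * 1) (at t)"
      by (rule DERIV_chain2[OF d]) (auto intro!: derivative_eq_intros)
    moreover have "((\<lambda>t. flat_exp 0 (a - t)) has_field_derivative flat_exp 2 (a - t) * (- 1)) (at t)"
      by (rule DERIV_chain2[OF d]) (auto intro!: derivative_eq_intros)
    ultimately show ?thesis
      unfolding g_def using DERIV_add by fastforce
  qed
  have "norm (g b - g 0) \<le> (72 * \<bar>b\<bar>) * norm (b - 0)"
  proof (rule field_differentiable_bound[where S="cball 0 \<bar>b\<bar>" and f'="\<lambda>t. flat_exp 2 (a + t) - flat_exp 2 (a - t)"])
    fix t :: real assume "t \<in> cball 0 \<bar>b\<bar>"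
    then have "\<bar>t\<bar> \<le> \<bar>b\<bar>" by simp
    then show "norm (flat_exp 2 (a + t) - flat_exp 2 (a - t)) \<le> 72 * \<bar>b\<bar>"
      using lip[of "a + t" "a - t"] by simp
    show "(g has_field_derivative flat_exp 2 (a + t) - flat_exp 2 (a - t)) (at t within cball 0 \<bar>b\<bar>)"
      using g' has_field_derivative_at_within by blast
  qed auto
  then show ?thesis by (simp add: g_def power2_eq_square abs_mult[symmetric] mult.assoc)
qed

lemma flat_exp_lipschitz: "\<bar>flat_exp 0 u - flat_exp 0 v\<bar> \<le> 2 * \<bar>u - v\<bar>"
proof -
  have "norm (flat_exp 0 u - flat_exp 0 v) \<le> 2 * norm (u - v)"
  proof (rule field_differentiable_bound[where S=UNIV and f'="\<lambda>t. flat_exp 2 t"])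
    fix t
    show "(flat_exp 0 has_field_derivative flat_exp 2 t) (at t within UNIV)"
      using DERIV_flat_exp[of 0 t] by (simp add: numeral_eq_Suc)
    show "norm (flat_exp 2 t) \<le> 2"
      using flat_exp_nonneg[of 2 t] flat_exp_le[of 2 t] by (auto simp: fact_numeral)
  qed auto
  then show ?thesis by simp
qed

lemma second_diff_bound: "\<bar>second_diff x y\<bar> \<le> 1200 * min 1 ((norm y)\<^sup>2)"
proof (cases "norm y \<le> 1")
  case True
  then have m: "min 1 ((norm y)\<^sup>2) = (norm y)\<^sup>2" by (simp add: abs_square_le_1)
  show ?thesis
  proof (cases "norm x \<le> 2")
    case x: True
    \<comment> \<open>The arguments 1 - |x \<plusminus> y|^2 equal \<open>p\<close> \<minusplus>
      \<open>b\<close>, so the problem becomes a one-dimensional second difference at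
      \<open>p\<close> with step \<open>b\<close>, plus the cost of replacing 1 - |x|^2 by
      \<open>p\<close>. As |b| \<le> 4|y|, the total is at most (72 * 16 + 4)|y|^2 = 1156
      |y|^2.\<close>
    define p where "p = 1 - x \<bullet> x - y \<bullet> y"
    define b where "b = 2 * (x \<bullet> y)"
    have 1: "std_bump (x + y) = flat_exp 0 (p - b)" "std_bump (x - y) = flat_exp 0 (p + b)"
      by (simp_all add: std_bump_def p_def b_def algebra_simps inner_commute)
    have "\<bar>x \<bullet> y\<bar> \<le> 2 * norm y"
      using Cauchy_Schwarz_ineq2[of x y] x mult_right_mono[of "norm x" 2 "norm y"] by simp
    then have "\<bar>b\<bar> \<le> 4 * norm y" by (simp add: b_def)
    then have b: "b\<^sup>2 \<le> 16 * (norm y)\<^sup>2"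
      using power_mono[of "\<bar>b\<bar>" "4 * norm y" 2] by (simp add: power_mult_distrib)
    have "\<bar>std_bump x - flat_exp 0 p\<bar> \<le> 2 * (norm y)\<^sup>2"
      using flat_exp_lipschitz[of "1 - x \<bullet> x" p]
      by (simp add: std_bump_def p_def power2_norm_eq_inner)
    then have "\<bar>second_diff x y\<bar> \<le> 72 * b\<^sup>2 + 4 * (norm y)\<^sup>2"
      using flat_exp_second_diff[of p b] unfolding second_diff_def 1 by linarith
    then show ?thesis using b unfolding m
      by (smt (verit) zero_le_power2)
  next
    case x: False
    then have "norm (x + y) \<ge> 1" "norm (x - y) \<ge> 1" "norm x \<ge> 1"
      using True norm_triangle_ineq2[of x "-y"] norm_triangle_ineq2[of x y] by auto
    then show ?thesis by (simp add: second_diff_def std_bump_eq_0)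
  qed
next
  case False
  then have "min 1 ((norm y)\<^sup>2) = 1" using abs_square_le_1[of "norm y"] by (simp add: min_def) 
  then show ?thesis
    using std_bump_bounds[of x] std_bump_bounds[of "x + y"] std_bump_bounds[of "x - y"]
    by (auto simp: second_diff_def abs_le_iff)
qed

section \<open>The fractional Laplacian of the bump\<close>

definition frac_kernel :: "real \<Rightarrow> 'a::euclidean_space \<Rightarrow> real" where
  "frac_kernel s y = 1 / norm y powr (real DIM('a) + 2 * s)"

text \<open>The closed half-line matches the complement of an open ball, over which
  \<open>frac_laplacian\<close> integrates before its limit.\<close>

definition trunc_kernel :: "real \<Rightarrow> real \<Rightarrow> 'a::euclidean_space \<Rightarrow> real" where
  "trunc_kernel s \<delta> y = indicator {\<delta>..} (norm y) * frac_kernel s y"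

definition frac_weight :: "real \<Rightarrow> 'a::euclidean_space \<Rightarrow> real" where
  "frac_weight s y = 1 / (1 + norm y) powr (real DIM('a) + 2 * s)"

text \<open>This is h of the overview. The division by 2 undoes the doubling by
  symmetrization.\<close>

definition bump_lap :: "real \<Rightarrow> 'a::euclidean_space \<Rightarrow> real" where
  "bump_lap s x = (\<integral>y. second_diff x y * frac_kernel s y \<partial>lborel) / 2"

definition bump_lap_trunc :: "real \<Rightarrow> real \<Rightarrow> 'a::euclidean_space \<Rightarrow> real" where
  "bump_lap_trunc s \<delta> x = (\<integral>y. second_diff x y * trunc_kernel s \<delta> y \<partial>lborel) / 2"

lemma borel_measurable_frac_kernel [measurable]: "frac_kernel s \<in> borel_measurable borel"
  unfolding frac_kernel_def by measurable

lemma borel_measurable_trunc_kernel [measurable]: "trunc_kernel s \<delta> \<in> borel_measurable borel"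
  unfolding trunc_kernel_def by measurable

lemma borel_measurable_frac_weight [measurable]: "frac_weight s \<in> borel_measurable borel"
  unfolding frac_weight_def by measurable

lemma borel_measurable_bump_lap [measurable]: "bump_lap s \<in> borel_measurable borel"
  unfolding bump_lap_def by measurable

lemma borel_measurable_bump_lap_trunc [measurable]: "bump_lap_trunc s \<delta> \<in> borel_measurable borel"
  unfolding bump_lap_trunc_def by measurable

lemma frac_kernel_nonneg [simp]: "0 \<le> frac_kernel s y"
  by (simp add: frac_kernel_def)

lemma trunc_kernel_nonneg [simp]: "0 \<le> trunc_kernel s \<delta> y"
  by (simp add: trunc_kernel_def)

lemma frac_weight_pos: "0 < frac_weight s y"
  using norm_ge_zero[of y] by (simp add: frac_weight_def add_nonneg_eq_0_iff)

lemma trunc_kernel_minus [simp]: "trunc_kernel s \<delta> (- y) = trunc_kernel s \<delta> y"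
  by (simp add: trunc_kernel_def frac_kernel_def)

lemma trunc_kernel_le: "trunc_kernel s \<delta> y \<le> frac_kernel s y"
  by (simp add: trunc_kernel_def indicator_def)

section \<open>Integrability of the kernels and the principal value for the bump\<close>

context
  fixes s :: real
  assumes s_pos: "0 < s" and s_less: "s < 1"
begin

text \<open>In polar coordinates the integrand is a multiple of t^(-1-2s), whose tail is finite
  because s > 0. The exact power \<rho>^(-2s) is what later gives the decay of the flux.\<close>

lemma nn_integral_trunc_kernel:
  assumes "0 < \<rho>"
  shows "(\<integral>\<^sup>+y. trunc_kernel s \<rho> (y::'a::euclidean_space) \<partial>lborel)
    = ennreal (real DIM('a) * unit_ball_vol DIM('a) / (2 * s) * \<rho> powr (- 2 * s))"
proof -
  let ?n = "DIM('a)" and ?\<omega> = "unit_ball_vol DIM('a)"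
  have "(\<integral>\<^sup>+y. trunc_kernel s \<rho> (y::'a) \<partial>lborel)
     = (\<integral>\<^sup>+y. ennreal (indicator {\<rho>..} (norm y) / norm y powr (real ?n + 2 * s)) \<partial>(lborel :: 'a measure))"
    by (simp add: trunc_kernel_def frac_kernel_def)
  also have "\<dots> = (\<integral>\<^sup>+t. ennreal (indicator {0..} t * (real ?n * ?\<omega> * t ^ (?n - 1))) *
        ennreal (indicator {\<rho>..} t / t powr (real ?n + 2 * s)) \<partial>lborel)"
    by (rule nn_integral_radial) simp
  also have "\<dots> = (\<integral>\<^sup>+t. ennreal (real ?n * ?\<omega> * t powr (- 1 - 2 * s)) * indicator {\<rho>..} t \<partial>lborel)"
  proof (rule nn_integral_cong)
    fix t :: real
    show "ennreal (indicator {0..} t * (real ?n * ?\<omega> * t ^ (?n - 1))) * ennreal (indicator {\<rho>..} t / t powr (real ?n + 2 * s))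
        = ennreal (real ?n * ?\<omega> * t powr (- 1 - 2 * s)) * indicator {\<rho>..} t"
    proof (cases "\<rho> \<le> t")
      case True
      then have t: "t > 0" using assms by simp
      have "t ^ (?n - 1) = t powr (- 1 - 2 * s) * t powr (real ?n + 2 * s)"
        using t by (simp add: powr_realpow[symmetric] of_nat_diff powr_add[symmetric])
      then show ?thesis using True t
        by (simp add: ennreal_mult'[symmetric] mult.assoc)
    qed simp
  qed
  also have "\<dots> = ennreal (0 - (- (real ?n * ?\<omega> / (2 * s) * \<rho> powr (- 2 * s))))"
  proof (rule nn_integral_FTC_atLeast)
    show "((\<lambda>t. - (real ?n * ?\<omega> / (2 * s) * t powr (- 2 * s))) has_real_derivative
        real ?n * ?\<omega> * t powr (- 1 - 2 * s)) (at t)" if "\<rho> \<le> t" for t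
    proof -
      have "- 1 - 2 * s = - 2 * s - 1" by simp
      then show ?thesis
        using that assms s_pos by (simp only:) (auto intro!: derivative_eq_intros simp: field_simps)
    qed
    have "((\<lambda>t. t powr (- 2 * s)) \<longlongrightarrow> 0) at_top"
      using s_pos by (intro tendsto_neg_powr filterlim_ident) auto
    from tendsto_mult_left[OF this, of "- (real ?n * ?\<omega> / (2 * s))"]
    show "((\<lambda>t. - (real ?n * ?\<omega> / (2 * s) * t powr (- 2 * s))) \<longlongrightarrow> 0) at_top" by simp
  qed auto
  finally show ?thesis by simp
qed

lemma integrable_trunc_kernel:
  assumes "0 < \<rho>"
  shows "integrable lborel (trunc_kernel s \<rho> :: 'a::euclidean_space \<Rightarrow> real)"
  using nn_integral_trunc_kernel[OF assms, where 'a='a] by (intro integrableI_nonneg) auto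

lemma integral_trunc_kernel:
  assumes "0 < \<rho>"
  shows "(\<integral>y. trunc_kernel s \<rho> (y::'a::euclidean_space) \<partial>lborel)
    = real DIM('a) * unit_ball_vol DIM('a) / (2 * s) * \<rho> powr (- 2 * s)"
  using nn_integral_trunc_kernel[OF assms, where 'a='a] s_pos
  by (subst integral_eq_nn_integral) auto

text \<open>Near the origin the radial density is t^(n-1) t^2 t^(-n-2s) = t^(1-2s), integrable
  because s < 1. Outside the unit ball only the truncated kernel remains.\<close>

lemma integrable_min_kernel:
  "integrable lborel (\<lambda>y::'a::euclidean_space. min 1 ((norm y)\<^sup>2) * frac_kernel s y)"
proof -
  let ?n = "DIM('a)" and ?\<omega> = "unit_ball_vol DIM('a)"
  let ?f = "\<lambda>y::'a. indicator {0..<1} (norm y) * ((norm y)\<^sup>2 * frac_kernel s y)"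
  have "(\<integral>\<^sup>+y. ?f y \<partial>lborel)
     = (\<integral>\<^sup>+y. ennreal (indicator {0..<1} (norm y) * ((norm y)\<^sup>2 / norm y powr (real ?n + 2 * s))) \<partial>(lborel :: 'a measure))"
    by (simp add: frac_kernel_def)
  also have "\<dots> = (\<integral>\<^sup>+t. ennreal (indicator {0..} t * (real ?n * ?\<omega> * t ^ (?n - 1))) *
        ennreal (indicator {0..<1} t * (t\<^sup>2 / t powr (real ?n + 2 * s))) \<partial>lborel)"
    by (rule nn_integral_radial) simp
  also have "\<dots> \<le> (\<integral>\<^sup>+t. ennreal (real ?n * ?\<omega> * (if t \<in> {0..1} then t powr (1 - 2 * s) else 0)) \<partial>lborel)"
  proof (rule nn_integral_mono)
    fix t :: real
    show "ennreal (indicator {0..} t * (real ?n * ?\<omega> * t ^ (?n - 1))) * ennreal (indicator {0..<1} t * (t\<^sup>2 / t powr (real ?n + 2 * s)))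
        \<le> ennreal (real ?n * ?\<omega> * (if t \<in> {0..1} then t powr (1 - 2 * s) else 0))"
    proof (cases "0 < t \<and> t < 1")
      case True
      then have t: "t > 0" "t < 1" by auto
      have "t ^ (?n - 1) = t powr (real ?n - 1)"
        using t by (simp add: powr_realpow[symmetric] of_nat_diff)
      moreover have "t\<^sup>2 = t powr 2" using t by simp
      ultimately have "t ^ (?n - 1) * t\<^sup>2 = t powr (real ?n - 1 + 2)"
        by (simp only: powr_add)
      then have "t ^ (?n - 1) * (t\<^sup>2 / t powr (real ?n + 2 * s)) = t powr ((real ?n - 1 + 2) - (real ?n + 2 * s))"
        by (simp only: powr_diff times_divide_eq_right)
      then have "t ^ (?n - 1) * (t\<^sup>2 / t powr (real ?n + 2 * s)) = t powr (1 - 2 * s)"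
        by simp
      then show ?thesis using t
        by (simp add: ennreal_mult'[symmetric] mult.assoc del: times_divide_eq_right)
    qed (auto simp: indicator_def)
  qed
  also have "\<dots> = ennreal (real ?n * ?\<omega>) * (\<integral>\<^sup>+t. ennreal (if t \<in> {0..1} then t powr (1 - 2 * s) else 0) \<partial>lborel)"
    by (subst nn_integral_cmult[symmetric]) (auto simp: ennreal_mult' intro!: nn_integral_cong)
  also have "(\<integral>\<^sup>+t. ennreal (if t \<in> {0..1} then t powr (1 - 2 * s) else 0) \<partial>lborel)
      = ennreal (1 powr (1 - 2 * s + 1) / (1 - 2 * s + 1))"
  proof (rule nn_integral_has_integral_lborel)
    show "((\<lambda>t. if t \<in> {0..1} then t powr (1 - 2 * s) else 0) has_integral
        1 powr (1 - 2 * s + 1) / (1 - 2 * s + 1)) UNIV"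
      unfolding has_integral_restrict_UNIV
      by (rule has_integral_powr_from_0) (use s_less in auto)
  qed auto
  also have "ennreal (real ?n * ?\<omega>) * \<dots> < \<infinity>" by (simp add: ennreal_mult_less_top)
  finally have "integrable lborel ?f"
    by (intro integrableI_nonneg) auto
  then have "integrable lborel (\<lambda>y::'a. ?f y + trunc_kernel s 1 y)"
    by (intro Bochner_Integration.integrable_add integrable_trunc_kernel) auto
  also have "(\<lambda>y::'a. ?f y + trunc_kernel s 1 y) = (\<lambda>y. min 1 ((norm y)\<^sup>2) * frac_kernel s y)"
  proof (rule ext)
    fix y :: 'a
    show "?f y + trunc_kernel s 1 y = min 1 ((norm y)\<^sup>2) * frac_kernel s y"
      using power_strict_mono[of "norm y" 1 2] power_mono[of 1 "norm y" 2]
      by (cases "norm y < 1") (auto simp: trunc_kernel_def)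
  qed
  finally show ?thesis .
qed

lemma integrable_frac_weight: "integrable lborel (frac_weight s :: 'a::euclidean_space \<Rightarrow> real)"
proof (rule Bochner_Integration.integrable_bound)
  show "integrable lborel (\<lambda>y::'a. indicator (ball 0 1) y + trunc_kernel s 1 y)"
    by (intro Bochner_Integration.integrable_add integrable_trunc_kernel integrable_indicator_ball) simp
  have "frac_weight s y \<le> indicator (ball 0 1) y + trunc_kernel s 1 y" for y :: 'a
  proof (cases "norm y < 1")
    case True
    have "1 \<le> (1 + norm y) powr (real DIM('a) + 2 * s)"
      using s_pos by (intro ge_one_powr_ge_zero) auto
    then show ?thesis using True
      by (auto simp: frac_weight_def trunc_kernel_def divide_le_eq_1)
  next
    case False
    have "norm y powr (real DIM('a) + 2 * s) \<le> (1 + norm y) powr (real DIM('a) + 2 * s)"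
      using s_pos by (intro powr_mono2) auto
    moreover have "0 < norm y powr (real DIM('a) + 2 * s)" using False by (simp add: not_less) auto
    ultimately show ?thesis using False
      by (auto simp: frac_weight_def trunc_kernel_def frac_kernel_def intro!: frac_le)
  qed
  then show "AE y in lborel. norm (frac_weight s y) \<le> norm (indicator (ball 0 1) y + trunc_kernel s 1 (y::'a))"
    by (simp add: abs_of_pos[OF frac_weight_pos])
qed simp

text \<open>600 is half of the constant 1200 of \<open>second_diff_bound\<close>. The argument only
  carries the type, and with it the dimension.\<close>

definition bump_lap_const :: "'a::euclidean_space itself \<Rightarrow> real" where
  "bump_lap_const _ = 600 * (\<integral>(y::'a). min 1 ((norm y)\<^sup>2) * frac_kernel s y \<partial>lborel)"

lemma second_diff_kernel_bounds:
  "\<bar>second_diff x y * frac_kernel s y\<bar> \<le> 1200 * (min 1 ((norm y)\<^sup>2) * frac_kernel s y)"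
  "\<bar>second_diff x y * trunc_kernel s \<delta> y\<bar> \<le> 1200 * (min 1 ((norm y)\<^sup>2) * frac_kernel s y)"
proof -
  have "\<bar>second_diff x y\<bar> * frac_kernel s y \<le> (1200 * min 1 ((norm y)\<^sup>2)) * frac_kernel s y"
    by (rule mult_right_mono[OF second_diff_bound]) simp
  moreover have "\<bar>second_diff x y\<bar> * trunc_kernel s \<delta> y \<le> \<bar>second_diff x y\<bar> * frac_kernel s y"
    by (rule mult_left_mono[OF trunc_kernel_le]) simp
  ultimately show "\<bar>second_diff x y * frac_kernel s y\<bar> \<le> 1200 * (min 1 ((norm y)\<^sup>2) * frac_kernel s y)"
    "\<bar>second_diff x y * trunc_kernel s \<delta> y\<bar> \<le> 1200 * (min 1 ((norm y)\<^sup>2) * frac_kernel s y)"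
    by (simp_all add: abs_mult mult.assoc)
qed

lemma integrable_second_diff_kernel:
  "integrable lborel (\<lambda>y::'a::euclidean_space. second_diff x y * frac_kernel s y)"
  "integrable lborel (\<lambda>y::'a::euclidean_space. second_diff x y * trunc_kernel s \<delta> y)"
  using second_diff_kernel_bounds[where x=x]
  by (auto intro!: Bochner_Integration.integrable_bound[OF integrable_mult_right[OF integrable_min_kernel, of 1200]]
      order_trans[OF _ abs_ge_self])

lemma bump_lap_bounded:
  fixes x :: "'a::euclidean_space"
  shows "\<bar>bump_lap s x\<bar> \<le> bump_lap_const TYPE('a)" "\<bar>bump_lap_trunc s \<delta> x\<bar> \<le> bump_lap_const TYPE('a)"
proof -
  let ?M = "\<lambda>y::'a. 1200 * (min 1 ((norm y)\<^sup>2) * frac_kernel s y)"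
  have M: "integrable lborel ?M" by (intro integrable_mult_right integrable_min_kernel)
  have "norm (\<integral>y. second_diff x y * frac_kernel s y \<partial>lborel) \<le> (\<integral>y. ?M y \<partial>lborel)"
    "norm (\<integral>y. second_diff x y * trunc_kernel s \<delta> y \<partial>lborel) \<le> (\<integral>y. ?M y \<partial>lborel)"
    by (rule Bochner_Integration.integral_norm_bound_integral[OF integrable_second_diff_kernel(1) M],
        use second_diff_kernel_bounds(1)[of x] in simp)
      (rule Bochner_Integration.integral_norm_bound_integral[OF integrable_second_diff_kernel(2) M],
        use second_diff_kernel_bounds(2)[of x] in simp)
  then show "\<bar>bump_lap s x\<bar> \<le> bump_lap_const TYPE('a)" "\<bar>bump_lap_trunc s \<delta> x\<bar> \<le> bump_lap_const TYPE('a)"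
    by (simp_all add: bump_lap_def bump_lap_trunc_def bump_lap_const_def)
qed

lemma bump_lap_trunc_tendsto:
  fixes x :: "'a::euclidean_space"
  shows "((\<lambda>\<delta>. bump_lap_trunc s \<delta> x) \<longlongrightarrow> bump_lap s x) (at_right 0)"
proof (rule tendsto_at_right_sequentially[of 0 1])
  fix S :: "nat \<Rightarrow> real"
  assume S: "\<And>n. 0 < S n" "S \<longlonglongrightarrow> 0"
  have "(\<lambda>n. \<integral>y. second_diff x y * trunc_kernel s (S n) y \<partial>lborel)
      \<longlonglongrightarrow> (\<integral>y. second_diff x y * frac_kernel s y \<partial>lborel)"
  proof (rule integral_dominated_convergence)
    show "integrable lborel (\<lambda>y::'a. 1200 * (min 1 ((norm y)\<^sup>2) * frac_kernel s y))"
      by (intro integrable_mult_right integrable_min_kernel)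
    show "AE y in lborel. (\<lambda>n. second_diff x y * trunc_kernel s (S n) y) \<longlonglongrightarrow> second_diff x y * frac_kernel s y"
    proof (rule AE_I2)
      fix y :: 'a
      show "(\<lambda>n. second_diff x y * trunc_kernel s (S n) y) \<longlonglongrightarrow> second_diff x y * frac_kernel s y"
      \<comment> \<open>Away from the origin the truncation is inactive once \<open>S n\<close> is
        below the norm of \<open>y\<close>. At the origin both kernels are 0, since division by zero
        gives 0.\<close>
      proof (cases "y = 0")
        case False
        then have "\<forall>\<^sub>F n in sequentially. S n < norm y"
          using S(2) by (intro order_tendstoD) auto
        then have "\<forall>\<^sub>F n in sequentially. second_diff x y * trunc_kernel s (S n) y = second_diff x y * frac_kernel s y"
          by eventually_elim (simp add: trunc_kernel_def)
        then show ?thesis by (rule tendsto_eventually)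
      qed (simp add: frac_kernel_def trunc_kernel_def)
    qed
  qed (use second_diff_kernel_bounds[of x] in auto)
  then show "(\<lambda>n. bump_lap_trunc s (S n) x) \<longlonglongrightarrow> bump_lap s x"
    unfolding bump_lap_trunc_def bump_lap_def by (intro tendsto_divide) auto
qed simp

lemma integrable_std_bump_diff_trunc:
  fixes x :: "'a::euclidean_space"
  assumes "0 < \<delta>"
  shows "integrable lborel (\<lambda>z. (std_bump x - std_bump z) * trunc_kernel s \<delta> (x - z))"
    and "integrable lborel (\<lambda>z. trunc_kernel s \<delta> (x - z))"
proof -
  have "integrable (distr lborel borel (\<lambda>y. x - y)) (trunc_kernel s \<delta>)"
    unfolding lborel_distr_minus by (rule integrable_trunc_kernel[OF assms])
  then show *: "integrable lborel (\<lambda>z. trunc_kernel s \<delta> (x - z))"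
    by (subst (asm) integrable_distr_eq) auto
  show "integrable lborel (\<lambda>z. (std_bump x - std_bump z) * trunc_kernel s \<delta> (x - z))"
  proof (rule Bochner_Integration.integrable_bound[OF *])
    have "\<bar>std_bump x - std_bump z\<bar> \<le> 1" for z
      using std_bump_bounds[of x] std_bump_bounds[of z] by (auto simp: abs_le_iff)
    then have "\<bar>std_bump x - std_bump z\<bar> * trunc_kernel s \<delta> (x - z) \<le> 1 * trunc_kernel s \<delta> (x - z)" for z
      by (rule mult_right_mono) simp
    then show "AE z in lborel. norm ((std_bump x - std_bump z) * trunc_kernel s \<delta> (x - z)) \<le> norm (trunc_kernel s \<delta> (x - z))"
      by (simp add: abs_mult)
  qed measurable
qed

text \<open>After truncation the two first differences in \<open>second_diff\<close> are integrable
  separately, and the substitutions z = x + y and z = x - y turn both into the same integral because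
  the kernel is even.\<close>

lemma bump_lap_trunc_eq:
  fixes x :: "'a::euclidean_space"
  assumes "0 < \<delta>"
  shows "bump_lap_trunc s \<delta> x = (\<integral>z. (std_bump x - std_bump z) * trunc_kernel s \<delta> (x - z) \<partial>lborel)"
    (is "_ = integral\<^sup>L _ ?g")
proof -
  have g[measurable]: "?g \<in> borel_measurable borel" by measurable
  have i: "integrable lborel ?g" by (rule integrable_std_bump_diff_trunc[OF assms])
  have 1: "integrable lborel (\<lambda>y. (std_bump x - std_bump (x + y)) * trunc_kernel s \<delta> y)"
    "(\<integral>y. (std_bump x - std_bump (x + y)) * trunc_kernel s \<delta> y \<partial>lborel) = integral\<^sup>L lborel ?g"
    using lborel_integrable_affine[OF g _ i, of 1 x] lborel_integral_affine[OF g, of 1 x] by simp_all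
  have 2: "integrable lborel (\<lambda>y. (std_bump x - std_bump (x - y)) * trunc_kernel s \<delta> y)"
    "(\<integral>y. (std_bump x - std_bump (x - y)) * trunc_kernel s \<delta> y \<partial>lborel) = integral\<^sup>L lborel ?g"
    using lborel_integrable_affine[OF g _ i, of "-1" x] lborel_integral_affine[OF g, of "-1" x] by simp_all
  have "2 * bump_lap_trunc s \<delta> x = (\<integral>y. (std_bump x - std_bump (x + y)) * trunc_kernel s \<delta> y
     + (std_bump x - std_bump (x - y)) * trunc_kernel s \<delta> y \<partial>lborel)"
    by (simp add: bump_lap_trunc_def second_diff_def algebra_simps)
  also have "\<dots> = 2 * integral\<^sup>L lborel ?g"
    using 1 2 by (simp add: Bochner_Integration.integral_add)
  finally show ?thesis by simp
qed

text \<open>An orthogonal map carrying \<open>x\<close> to \<open>y\<close> preserves Lebesgue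
  measure, the bump and the kernel. This is what allows integrals of \<open>bump_lap\<close> over
  shells to be computed in polar coordinates.\<close>

lemma bump_lap_radial:
  fixes x y :: "'a::euclidean_space"
  assumes "norm x = norm y"
  shows "bump_lap s x = bump_lap s y"
proof -
  obtain T :: "'a \<Rightarrow> 'a" where T: "orthogonal_transformation T" "T x = y"
    using exists_orthogonal_transformation[OF assms] .
  have lin: "linear T" and norm: "norm (T z) = norm z" for z
    using T(1) by (simp_all add: orthogonal_transformation)
  have [measurable]: "T \<in> borel_measurable borel"
    using lin linear_continuous_on linear_conv_bounded_linear by (metis borel_measurable_continuous_onI)
  have bump: "std_bump (T z) = std_bump z" for z
    using norm[of z] by (simp add: std_bump_def flip: power2_norm_eq_inner)
  have "(\<integral>z. second_diff y z * frac_kernel s z \<partial>lborel) =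
      (\<integral>z. second_diff (T x) z * frac_kernel s z \<partial>distr lborel borel T)"
    by (simp add: lborel_distr_orthogonal[OF T(1)] T(2))
  also have "\<dots> = (\<integral>z. second_diff (T x) (T z) * frac_kernel s (T z) \<partial>lborel)"
    by (rule integral_distr) auto
  also have "\<dots> = (\<integral>z. second_diff x z * frac_kernel s z \<partial>lborel)"
    by (simp add: second_diff_def frac_kernel_def bump norm flip: linear_add[OF lin] linear_diff[OF lin])
  finally show ?thesis by (simp add: bump_lap_def)
qed

end

lemma integrable_indicator_times:
  fixes f :: "'b \<Rightarrow> real"
  shows "A \<in> sets M \<Longrightarrow> integrable M f \<Longrightarrow> integrable M (\<lambda>x. indicator A x * f x)"
  using integrable_mult_indicator[of A M f] by simp

text \<open>All comparisons between kernels and weights are reduced through this to a linear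
  inequality between their bases.\<close>

lemma inverse_powr_scale_le:
  fixes a b p c :: real
  assumes "0 < a" "0 < c" "a \<le> c * b" "0 \<le> p"
  shows "1 / b powr p \<le> c powr p / a powr p"
proof -
  have b: "0 < b"
  proof (rule ccontr)
    assume "\<not> 0 < b"
    then have "c * b \<le> 0" using assms by (simp add: mult_nonneg_nonpos)
    with assms show False by simp
  qed
  have "a powr p \<le> (c * b) powr p" using assms by (intro powr_mono2) auto
  also have "\<dots> = c powr p * b powr p" using assms b by (simp add: powr_mult)
  finally show ?thesis using assms b by (simp add: field_simps)
qed

lemma integrable_std_bump: "integrable lborel (std_bump :: 'a::euclidean_space \<Rightarrow> real)"
  and integral_std_bump_le: "(\<integral>x. std_bump (x::'a) \<partial>lborel) \<le> unit_ball_vol DIM('a)"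
proof -
  have i: "integrable lborel (indicator (ball 0 1) :: 'a \<Rightarrow> real)"
    by (rule integrable_indicator_ball)
  have b: "std_bump x \<le> indicator (ball 0 1) x" for x :: 'a
    using std_bump_bounds(2)[of x] std_bump_eq_0[of x] by (auto simp: indicator_def)
  show 1: "integrable lborel (std_bump :: 'a \<Rightarrow> real)"
    by (rule Bochner_Integration.integrable_bound[OF i])
      (use b in \<open>auto simp: std_bump_bounds abs_of_nonneg\<close>)
  have "(\<integral>x. std_bump (x::'a) \<partial>lborel) \<le> (\<integral>x. indicator (ball (0::'a) 1) x \<partial>lborel)"
    by (rule integral_mono[OF 1 i b])
  then show "(\<integral>x. std_bump (x::'a) \<partial>lborel) \<le> unit_ball_vol DIM('a)"
    by (simp add: content_ball)
qed

text \<open>On the ball of radius min \<rho> 1 / 2 one has 1 - |x|^2 \<ge> 1/2, so the bump is at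
  least exp(-2) there.\<close>

lemma integral_std_bump_ball_ge:
  assumes "0 < \<rho>"
  shows "exp (- 2) * unit_ball_vol DIM('a) * (min \<rho> 1 / 2) ^ DIM('a)
    \<le> (\<integral>(x::'a::euclidean_space). indicator (ball 0 \<rho>) x * std_bump x \<partial>lborel)"
proof -
  let ?r = "min \<rho> 1 / 2"
  have "(\<integral>(x::'a). indicator (ball 0 ?r) x * exp (- 2) \<partial>lborel)
      \<le> (\<integral>x. indicator (ball 0 \<rho>) (x::'a) * std_bump x \<partial>lborel)"
  proof (rule integral_mono)
    show "integrable lborel (\<lambda>x::'a. indicator (ball 0 ?r) x * exp (- 2) :: real)"
      by (intro integrable_mult_left integrable_indicator_ball)
    show "integrable lborel (\<lambda>x::'a. indicator (ball 0 \<rho>) x * std_bump x)"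
      by (intro integrable_indicator_times integrable_std_bump) auto
    show "indicator (ball 0 ?r) x * exp (- 2) \<le> indicator (ball 0 \<rho>) x * std_bump x" for x :: 'a
    proof (cases "x \<in> ball 0 ?r")
      case True
      then have x: "norm x \<le> 1 / 2" "norm x < \<rho>" using assms by auto
      have "(norm x)\<^sup>2 \<le> (1 / 2)\<^sup>2" using x by (intro power_mono) auto
      then have "x \<bullet> x \<le> (1 / 2)\<^sup>2" by (simp only: power2_norm_eq_inner)
      then have "1 / 2 \<le> 1 - x \<bullet> x" by (simp add: power2_eq_square)
      then have "exp (- 2) \<le> std_bump x"
        by (simp add: std_bump_def flat_exp_def field_simps)
      then show ?thesis using x True by simp
    qed (simp add: std_bump_bounds)
  qed
  then show ?thesis using assms by (simp add: content_ball mult_ac)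
qed

section \<open>Decay of h and its flux through spheres\<close>

context
  fixes s :: real
  assumes s_pos: "0 < s" and s_less: "s < 1"
begin

text \<open>Here the bump vanishes at \<open>x\<close>, so only the two shifted bumps contribute. On
  their supports x + y or x - y lies in the unit ball, whence |x| \<le> 2|y| and the kernel is at
  most 2^(n+2s) times its value at \<open>x\<close>.\<close>

lemma bump_lap_decay:
  fixes x :: "'a::euclidean_space"
  assumes x: "2 \<le> norm x"
  shows "\<bar>bump_lap s x\<bar> \<le> 2 powr (real DIM('a) + 2 * s) * unit_ball_vol DIM('a) * frac_kernel s x"
proof -
  let ?\<sigma> = "real DIM('a) + 2 * s"
  let ?c = "2 powr ?\<sigma> / norm x powr ?\<sigma>"
  have c: "?c \<ge> 0" by simp
  have i1: "integrable lborel (\<lambda>y. std_bump (x + y))" "(\<integral>y. std_bump (x + y) \<partial>lborel) = (\<integral>y. std_bump (y::'a) \<partial>lborel)"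
    using lborel_integrable_affine[OF _ _ integrable_std_bump[where 'a='a], of 1 x]
      lborel_integral_affine[of "std_bump :: 'a \<Rightarrow> real" 1 x] by simp_all
  have i2: "integrable lborel (\<lambda>y. std_bump (x - y))" "(\<integral>y. std_bump (x - y) \<partial>lborel) = (\<integral>y. std_bump (y::'a) \<partial>lborel)"
    using lborel_integrable_affine[OF _ _ integrable_std_bump[where 'a='a], of "-1" x]
      lborel_integral_affine[of "std_bump :: 'a \<Rightarrow> real" "-1" x] by simp_all
  have bd: "std_bump z * frac_kernel s y \<le> std_bump z * ?c" if "z = x + y \<or> z = x - y" for y z
  proof (cases "norm z < 1")
    case True
    have "norm x \<le> norm z + norm y"
      using that norm_triangle_ineq4[of z y] norm_triangle_ineq[of z y] by auto
    then have "norm x \<le> 2 * norm y" using True x by linarith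
    then have "frac_kernel s y \<le> ?c"
      unfolding frac_kernel_def using x s_pos by (intro inverse_powr_scale_le) auto
    then show ?thesis by (intro mult_left_mono std_bump_bounds)
  qed (simp add: std_bump_eq_0)
  have "norm (\<integral>y. second_diff x y * frac_kernel s y \<partial>lborel)
      \<le> (\<integral>y. std_bump (x + y) * ?c + std_bump (x - y) * ?c \<partial>lborel)"
  proof (rule Bochner_Integration.integral_norm_bound_integral)
    show "integrable lborel (\<lambda>y. second_diff x y * frac_kernel s y)"
      by (rule integrable_second_diff_kernel[OF s_pos s_less])
    show "integrable lborel (\<lambda>y. std_bump (x + y) * ?c + std_bump (x - y) * ?c)"
      by (intro Bochner_Integration.integrable_add integrable_mult_left i1 i2)
    fix y :: 'a
    have "second_diff x y = - (std_bump (x + y) + std_bump (x - y))"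
      using x by (simp add: second_diff_def std_bump_eq_0)
    then have "norm (second_diff x y * frac_kernel s y)
        = std_bump (x + y) * frac_kernel s y + std_bump (x - y) * frac_kernel s y"
      using std_bump_bounds(1)[of "x + y"] std_bump_bounds(1)[of "x - y"]
      by (simp add: abs_mult abs_of_nonneg distrib_right del: minus_add_distrib)
    then show "norm (second_diff x y * frac_kernel s y) \<le> std_bump (x + y) * ?c + std_bump (x - y) * ?c"
      using bd[of "x + y" y] bd[of "x - y" y] by simp
  qed
  also have "\<dots> = 2 * ((\<integral>y. std_bump (y::'a) \<partial>lborel) * ?c)"
    using i1 i2 by (simp add: Bochner_Integration.integral_add)
  also have "\<dots> \<le> 2 * (unit_ball_vol DIM('a) * ?c)"
    by (intro mult_left_mono mult_right_mono integral_std_bump_le c) simp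
  finally show ?thesis
    by (simp add: bump_lap_def frac_kernel_def mult_ac)
qed

lemma bump_lap_le_weight:
  obtains C where "0 < C" "\<And>x::'a::euclidean_space. \<bar>bump_lap s x\<bar> \<le> C * frac_weight s x"
proof
  let ?\<sigma> = "real DIM('a) + 2 * s"
  let ?C0 = "\<bar>bump_lap_const s TYPE('a)\<bar>" and ?\<omega> = "unit_ball_vol DIM('a)"
  \<comment> \<open>The base 3 serves both cases: 1 + |x| \<le> 3 when |x| \<le> 2, and otherwise 1
    + |x| \<le> (3/2)|x|, which combines with the factor 2 of \<open>bump_lap_decay\<close>.\<close>
  show "0 < 3 powr ?\<sigma> * (?C0 + ?\<omega>)"
    by (intro mult_pos_pos add_nonneg_pos) auto
  fix x :: 'a
  show "\<bar>bump_lap s x\<bar> \<le> 3 powr ?\<sigma> * (?C0 + ?\<omega>) * frac_weight s x"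
  proof (cases "norm x \<le> 2")
    case True
    have "1 / 1 powr ?\<sigma> \<le> 3 powr ?\<sigma> / (1 + norm x) powr ?\<sigma>"
      using True s_pos by (intro inverse_powr_scale_le) (auto intro: add_pos_nonneg)
    then have 1: "1 \<le> 3 powr ?\<sigma> * frac_weight s x" by (simp add: frac_weight_def)
    have "\<bar>bump_lap s x\<bar> \<le> ?C0 * 1"
      using bump_lap_bounded(1)[OF s_pos s_less, of x] by simp
    also have "\<dots> \<le> (?C0 + ?\<omega>) * (3 powr ?\<sigma> * frac_weight s x)"
      using 1 by (intro mult_mono) auto
    finally show ?thesis by (simp add: mult_ac)
  next
    case False
    have "1 / norm x powr ?\<sigma> \<le> (3/2) powr ?\<sigma> / (1 + norm x) powr ?\<sigma>"
      using False s_pos by (intro inverse_powr_scale_le) (auto intro: add_pos_nonneg)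
    then have "frac_kernel s x \<le> (3/2) powr ?\<sigma> * frac_weight s x"
      by (simp add: frac_weight_def frac_kernel_def)
    then have "2 powr ?\<sigma> * ?\<omega> * frac_kernel s x \<le> 2 powr ?\<sigma> * ?\<omega> * ((3/2) powr ?\<sigma> * frac_weight s x)"
      by (intro mult_left_mono) auto
    also have "\<dots> = 3 powr ?\<sigma> * ?\<omega> * frac_weight s x"
      using powr_mult[of 2 "3/2" ?\<sigma>] by simp
    also have "\<dots> \<le> 3 powr ?\<sigma> * (?C0 + ?\<omega>) * frac_weight s x"
      using frac_weight_pos[of s x] by (intro mult_right_mono mult_left_mono) auto
    finally show ?thesis using bump_lap_decay[of x] False by simp
  qed
qed

text \<open>The interaction of the ball with itself cancels by antisymmetry. The truncation makes all
  double integrals absolutely convergent.\<close>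
lemma bump_lap_trunc_flux:
  fixes \<rho> :: real
  assumes \<delta>: "0 < \<delta>"
  defines "B \<equiv> ball (0::'a::euclidean_space) \<rho>"
  shows "integrable lborel (\<lambda>x::'a. indicator B x *
      (\<integral>z. indicator (- B) z * ((std_bump x - std_bump z) * trunc_kernel s \<delta> (x - z)) \<partial>lborel))" (is ?th1)
    and "(\<integral>(x::'a). indicator B x * bump_lap_trunc s \<delta> x \<partial>lborel) = (\<integral>x. indicator B x *
      (\<integral>z. indicator (- B) z * ((std_bump x - std_bump z) * trunc_kernel s \<delta> (x - z)) \<partial>lborel) \<partial>lborel)" (is ?th2)
proof -
  have [measurable]: "B \<in> sets borel" by (simp add: B_def)
  define g where "g x z = (std_bump x - std_bump z) * trunc_kernel s \<delta> (x - z)" for x z :: 'a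
  have g_meas[measurable]: "(\<lambda>(x, z). g x z) \<in> borel_measurable (borel \<Otimes>\<^sub>M borel)"
    unfolding g_def by measurable
  have g_int: "integrable lborel (\<lambda>z. indicator A z * g x z)" if [measurable]: "A \<in> sets borel" for x A
    unfolding g_def by (intro integrable_indicator_times integrable_std_bump_diff_trunc[OF s_pos s_less \<delta>]) auto
  let ?K = "\<integral>y. trunc_kernel s \<delta> (y::'a) \<partial>lborel"
  have g_le: "\<bar>g x z\<bar> \<le> trunc_kernel s \<delta> (x - z)" for x z
  proof -
    have "\<bar>std_bump x - std_bump z\<bar> \<le> 1"
      using std_bump_bounds[of x] std_bump_bounds[of z] by (auto simp: abs_le_iff)
    then have "\<bar>std_bump x - std_bump z\<bar> * trunc_kernel s \<delta> (x - z) \<le> 1 * trunc_kernel s \<delta> (x - z)"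
      by (rule mult_right_mono) simp
    then show ?thesis by (simp add: g_def abs_mult)
  qed
  have inner_le: "\<bar>\<integral>z. indicator A z * g x z \<partial>lborel\<bar> \<le> ?K" if [measurable]: "A \<in> sets borel" for x A
  proof -
    have "norm (\<integral>z. indicator A z * g x z \<partial>lborel) \<le> (\<integral>z. trunc_kernel s \<delta> (x - z) \<partial>lborel)"
    proof (rule Bochner_Integration.integral_norm_bound_integral)
      show "norm (indicator A z * g x z) \<le> trunc_kernel s \<delta> (x - z)" for z
        using g_le[of x z] by (auto simp: indicator_def)
    qed (intro g_int that integrable_std_bump_diff_trunc[OF s_pos s_less \<delta>])+
    also have "\<dots> = ?K"
      using lborel_integral_affine[of "trunc_kernel s \<delta> :: 'a \<Rightarrow> real" "-1" x] by simp
    finally show ?thesis by simp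
  qed
  have B_fin: "integrable lborel (\<lambda>x. indicator B x * c)" for c :: real
    unfolding B_def by (intro integrable_mult_left integrable_indicator_ball)
  have outer: "integrable lborel (\<lambda>x. indicator B x * (\<integral>z. indicator A z * g x z \<partial>lborel))"
    if [measurable]: "A \<in> sets borel" for A
  proof (rule Bochner_Integration.integrable_bound[OF B_fin[of ?K]])
    show "AE x in lborel. norm (indicator B x * (\<integral>z. indicator A z * g x z \<partial>lborel)) \<le> norm (indicator B x * ?K)"
      using inner_le[OF that] by (intro AE_I2) (auto simp: indicator_def intro: order_trans[OF _ abs_ge_self])
  qed measurable
  show ?th1 using outer[of "- B"] by (simp add: g_def)
  define I where "I = (\<integral>x. (\<integral>z. indicator B x * (indicator B z * g x z) \<partial>lborel) \<partial>lborel)"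
  have "I = (\<integral>z. (\<integral>x. indicator B x * (indicator B z * g x z) \<partial>lborel) \<partial>lborel)"
    unfolding I_def
  proof (rule lborel_pair.Fubini_integral[symmetric])
    show "integrable (lborel \<Otimes>\<^sub>M lborel) (\<lambda>(x, z). indicator B x * (indicator B z * g x z))"
    proof (rule integrableI_bounded_set[where A="B \<times> B" and B="1 / \<delta> powr (real DIM('a) + 2 * s)"])
      show "emeasure (lborel \<Otimes>\<^sub>M lborel) (B \<times> B) < \<infinity>"
        using emeasure_lborel_ball_finite[of "0::'a" \<rho>]
        by (subst lborel.emeasure_pair_measure_Times) (auto simp: B_def ennreal_mult_less_top)
      have "\<bar>g x z\<bar> \<le> 1 / \<delta> powr (real DIM('a) + 2 * s)" for x z
      proof (rule order_trans[OF g_le])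
        show "trunc_kernel s \<delta> (x - z) \<le> 1 / \<delta> powr (real DIM('a) + 2 * s)"
          using \<delta> s_pos by (auto simp: trunc_kernel_def frac_kernel_def indicator_def intro!: frac_le powr_mono2)
      qed
      then show "AE p\<in>B \<times> B in lborel \<Otimes>\<^sub>M lborel. norm (case p of (x, z) \<Rightarrow> indicator B x * (indicator B z * g x z))
          \<le> 1 / \<delta> powr (real DIM('a) + 2 * s)"
        by (intro AE_I2) auto
    qed (auto simp: indicator_def)
  qed
  also have "\<dots> = (\<integral>z. (\<integral>x. - (indicator B z * (indicator B x * g z x)) \<partial>lborel) \<partial>lborel)"
  proof -
    have "g x z = - g z x" for x z
      using trunc_kernel_minus[of s \<delta> "x - z"] by (simp add: g_def algebra_simps)
    then have "indicator B x * (indicator B z * g x z) = - (indicator B z * (indicator B x * g z x))" for x z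
      by (metis mult.left_commute mult_minus_right)
    then show ?thesis by (intro Bochner_Integration.integral_cong refl)
  qed
  also have "\<dots> = - I" by (simp add: I_def)
  finally have I: "I = 0" by simp
  have "(\<integral>(x::'a). indicator B x * bump_lap_trunc s \<delta> x \<partial>lborel)
    = (\<integral>x. indicator B x * (\<integral>z. indicator B z * g x z \<partial>lborel)
        + indicator B x * (\<integral>z. indicator (- B) z * g x z \<partial>lborel) \<partial>lborel)"
  proof (rule Bochner_Integration.integral_cong[OF refl])
    fix x :: 'a
    have "bump_lap_trunc s \<delta> x = (\<integral>z. indicator B z * g x z + indicator (- B) z * g x z \<partial>lborel)"
      unfolding bump_lap_trunc_eq[OF s_pos s_less \<delta>] g_def
      by (rule Bochner_Integration.integral_cong) (auto simp: indicator_def)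
    also have "\<dots> = (\<integral>z. indicator B z * g x z \<partial>lborel) + (\<integral>z. indicator (- B) z * g x z \<partial>lborel)"
      by (intro Bochner_Integration.integral_add g_int) auto
    finally show "indicator B x * bump_lap_trunc s \<delta> x = indicator B x * (\<integral>z. indicator B z * g x z \<partial>lborel)
        + indicator B x * (\<integral>z. indicator (- B) z * g x z \<partial>lborel)"
      by (simp add: distrib_left)
  qed
  also have "\<dots> = I + (\<integral>x. indicator B x * (\<integral>z. indicator (- B) z * g x z \<partial>lborel) \<partial>lborel)"
    unfolding I_def by (subst Bochner_Integration.integral_add) (auto intro!: outer)
  finally show ?th2 unfolding g_def I by simp
qed

lemma bump_lap_trunc_flux_tendsto:
  "(\<lambda>k. \<integral>(x::'a::euclidean_space). indicator (ball 0 \<rho>) x * bump_lap_trunc s (1 / Suc k) x \<partial>lborel)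
    \<longlonglongrightarrow> (\<integral>x. indicator (ball 0 \<rho>) (x::'a) * bump_lap s x \<partial>lborel)"
proof (rule integral_dominated_convergence)
  show "integrable lborel (\<lambda>x::'a. indicator (ball 0 \<rho>) x * bump_lap_const s TYPE('a))"
    by (intro integrable_mult_left integrable_indicator_ball)
  have "filterlim (\<lambda>k. 1 / real (Suc k)) (at_right 0) sequentially"
    unfolding filterlim_at using LIMSEQ_inverse_real_of_nat by (auto simp: inverse_eq_divide)
  then show "AE x in lborel. (\<lambda>k. indicator (ball 0 \<rho>) x * bump_lap_trunc s (1 / Suc k) x)
      \<longlonglongrightarrow> indicator (ball 0 \<rho>) (x::'a) * bump_lap s x"
    by (intro AE_I2 tendsto_mult_left filterlim_compose[OF bump_lap_trunc_tendsto[OF s_pos s_less]])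
  show "AE x in lborel. norm (indicator (ball 0 \<rho>) x * bump_lap_trunc s (1 / Suc k) x)
      \<le> indicator (ball 0 \<rho>) (x::'a) * bump_lap_const s TYPE('a)" for k
    using bump_lap_bounded(2)[OF s_pos s_less] by (intro AE_I2) (auto simp: indicator_def)
  have [measurable]: "ball (0::'a) \<rho> \<in> sets borel" by simp
  show "(\<lambda>x::'a. indicator (ball 0 \<rho>) x * bump_lap s x) \<in> borel_measurable lborel"
    "(\<lambda>x::'a. indicator (ball 0 \<rho>) x * bump_lap_trunc s (1 / Suc k) x) \<in> borel_measurable lborel" for k
    by measurable
qed

end

section \<open>The averaging kernel\<close>

text \<open>The value at \<open>x = 0\<close> is the junk value 0, hence the exclusion of the origin in lower bounds.\<close>
definition flux_kernel :: "real \<Rightarrow> 'a::euclidean_space \<Rightarrow> real" where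
  "flux_kernel s x = (\<integral>z. indicator (ball 0 (norm x)) (z::'a) * bump_lap s z \<partial>lborel) / norm x ^ DIM('a)"

section \<open>Two-sided bounds for the flux kernel and its dependence on the scale\<close>

context
  fixes s :: real
  assumes s_pos: "0 < s" and s_less: "s < 1"
begin

lemma integrable_ball_bump_lap:
  "integrable lborel (\<lambda>x::'a::euclidean_space. indicator (ball 0 \<rho>) x * bump_lap s x)"
proof (rule Bochner_Integration.integrable_bound)
  show "integrable lborel (\<lambda>x::'a. indicator (ball 0 \<rho>) x * bump_lap_const s TYPE('a))"
    by (intro integrable_mult_left integrable_indicator_ball)
  show "AE x in lborel. norm (indicator (ball 0 \<rho>) x * bump_lap s x)
      \<le> norm (indicator (ball 0 \<rho>) (x::'a) * bump_lap_const s TYPE('a))"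
    using bump_lap_bounded(1)[OF s_pos s_less]
    by (intro AE_I2) (auto simp: indicator_def intro: order_trans[OF _ abs_ge_self])
  have [measurable]: "ball (0::'a) \<rho> \<in> sets borel" by simp
  show "(\<lambda>x::'a. indicator (ball 0 \<rho>) x * bump_lap s x) \<in> borel_measurable lborel"
    by measurable
qed

text \<open>Every pair in the flux formula contributes a nonnegative amount because the bump is
  radially decreasing, so a convenient set of exterior points may be selected. Taking
  \<open>m\<close> as the maximum of \<rho> and 1 treats small and large radii together. The bound
  is uniform in the truncation and passes to the limit.\<close>

lemma bump_lap_flux_lower:
  fixes \<rho> :: real
  assumes \<rho>: "0 < \<rho>"
  defines "m \<equiv> max \<rho> 1" and "\<sigma> \<equiv> real DIM('a) + 2 * s" and "\<omega> \<equiv> unit_ball_vol DIM('a)"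
  shows "\<omega> * m ^ DIM('a) / (5 * m) powr \<sigma> * (exp (- 2) * \<omega> * (min \<rho> 1 / 2) ^ DIM('a))
    \<le> (\<integral>x. indicator (ball 0 \<rho>) (x::'a::euclidean_space) * bump_lap s x \<partial>lborel)"
proof (rule order_trans)
  have m: "\<rho> \<le> m" "1 \<le> m" by (auto simp: m_def)
  let ?c = "\<omega> * m ^ DIM('a) / (5 * m) powr \<sigma>"
  have c: "0 \<le> ?c" using m by (auto simp: \<omega>_def)
  let ?P = "\<integral>x. indicator (ball 0 \<rho>) (x::'a) * std_bump x \<partial>lborel"
  show "?c * (exp (- 2) * \<omega> * (min \<rho> 1 / 2) ^ DIM('a)) \<le> ?c * ?P"
    unfolding \<omega>_def using c by (intro mult_left_mono integral_std_bump_ball_ge \<rho>) (auto simp: \<omega>_def)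
  have "?c * ?P \<le> (\<integral>x. indicator (ball 0 \<rho>) (x::'a) * bump_lap_trunc s (1 / Suc k) x \<partial>lborel)" for k
  proof -
    let ?\<delta> = "1 / real (Suc k)"
    have \<delta>: "0 < ?\<delta>" "?\<delta> \<le> 1" by auto
    note fl = bump_lap_trunc_flux[OF s_pos s_less \<delta>(1), where \<rho>=\<rho> and 'a='a]
    \<comment> \<open>bound the flux from below by its part into the ball of radius \<open>m\<close> around \<open>e\<close>, outside the bump\<close>
    obtain e :: 'a where e: "norm e = 3 * m"
      using vector_choose_size[of "3 * m"] m by auto
    have "?c * ?P = (\<integral>x. indicator (ball 0 \<rho>) (x::'a) * (?c * std_bump x) \<partial>lborel)"
      by (subst integral_mult_right_zero[symmetric])
        (rule Bochner_Integration.integral_cong[OF refl], simp only: mult.left_commute)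
    also have "\<dots> \<le> (\<integral>x. indicator (ball 0 \<rho>) (x::'a) *
        (\<integral>z. indicator (- ball 0 \<rho>) z * ((std_bump x - std_bump z) * trunc_kernel s ?\<delta> (x - z)) \<partial>lborel) \<partial>lborel)"
    proof (rule integral_mono[OF _ fl(1)])
      show "integrable lborel (\<lambda>x::'a. indicator (ball 0 \<rho>) x * (?c * std_bump x))"
        by (intro integrable_indicator_times integrable_mult_right integrable_std_bump) auto
      fix x :: 'a
      have "?c * std_bump x
          \<le> (\<integral>z. indicator (- ball 0 \<rho>) z * ((std_bump x - std_bump z) * trunc_kernel s ?\<delta> (x - z)) \<partial>lborel)"
        if x: "x \<in> ball 0 \<rho>"
      proof -
        have "?c * std_bump x = (\<integral>z. indicator (ball e m) z * (std_bump x / (5 * m) powr \<sigma>) \<partial>lborel)"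
          using m by (simp add: content_ball \<omega>_def)
        also have "\<dots> \<le> (\<integral>z. indicator (- ball 0 \<rho>) z * ((std_bump x - std_bump z) * trunc_kernel s ?\<delta> (x - z)) \<partial>lborel)"
        proof (rule integral_mono)
          show "integrable lborel (\<lambda>z. indicator (ball e m) z * (std_bump x / (5 * m) powr \<sigma>))"
            by (intro integrable_mult_left integrable_indicator_ball)
          show "integrable lborel (\<lambda>z. indicator (- ball 0 \<rho>) z * ((std_bump x - std_bump z) * trunc_kernel s ?\<delta> (x - z)))"
            by (intro integrable_indicator_times
                integrable_std_bump_diff_trunc[OF s_pos s_less \<delta>(1)]) auto
          fix z :: 'a
          show "indicator (ball e m) z * (std_bump x / (5 * m) powr \<sigma>)
              \<le> indicator (- ball 0 \<rho>) z * ((std_bump x - std_bump z) * trunc_kernel s ?\<delta> (x - z))"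
          proof (cases "z \<in> ball e m")
            case True
            \<comment> \<open>With |x| < \<rho> \<le> m these bounds put z outside both the bump and
              the ball of radius \<rho>, and give m \<le> |x - z| \<le> 5m.\<close>
            have "2 * m < norm z" "norm z < 4 * m"
              using True e norm_triangle_ineq2[of e "e - z"] norm_triangle_ineq4[of e "e - z"]
              by (auto simp: dist_norm)
            moreover have "norm z - norm x \<le> norm (x - z)" "norm (x - z) \<le> norm x + norm z"
              using norm_triangle_ineq3[of x z] norm_triangle_ineq4[of x z] by auto
            ultimately have z: "norm z \<ge> 1" "z \<notin> ball 0 \<rho>" "m \<le> norm (x - z)" "norm (x - z) \<le> 5 * m"
              using x m by auto
            have "norm (x - z) powr \<sigma> \<le> (5 * m) powr \<sigma>" "0 < norm (x - z) powr \<sigma>"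
              using z m s_pos by (auto simp: \<sigma>_def intro!: powr_mono2)
            \<comment> \<open>Since m \<ge> 1 \<ge> \<open>?\<delta>\<close>, the truncation has no
              effect on the selected pairs.\<close>
            moreover have "?\<delta> \<le> norm (x - z)" using z(3) \<delta>(2) m(2) by linarith
            then have "indicator {?\<delta>..} (norm (x - z)) = (1::real)" by (simp only: indicator_simps atLeast_iff)
            ultimately have "1 / (5 * m) powr \<sigma> \<le> trunc_kernel s ?\<delta> (x - z)"
              unfolding trunc_kernel_def frac_kernel_def \<sigma>_def[symmetric]
              by (simp only: mult_1) (rule frac_le; simp)
            then have "std_bump x * (1 / (5 * m) powr \<sigma>) \<le> std_bump x * trunc_kernel s ?\<delta> (x - z)"
              by (intro mult_left_mono std_bump_bounds)
            then show ?thesis using z True by (simp add: std_bump_eq_0)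
          next
            case False
            show ?thesis
            proof (cases "z \<in> ball 0 \<rho>")
              case z: False
              then have "std_bump z \<le> std_bump x" using x by (intro std_bump_norm_mono) auto
              then show ?thesis using False z by simp
            qed (use False in simp)
          qed
        qed
        finally show ?thesis .
      qed
      then show "indicator (ball 0 \<rho>) x * (?c * std_bump x) \<le> indicator (ball 0 \<rho>) x *
        (\<integral>z. indicator (- ball 0 \<rho>) z * ((std_bump x - std_bump z) * trunc_kernel s ?\<delta> (x - z)) \<partial>lborel)"
        by (cases "x \<in> ball 0 \<rho>") auto
    qed
    also have "\<dots> = (\<integral>x. indicator (ball 0 \<rho>) (x::'a) * bump_lap_trunc s ?\<delta> x \<partial>lborel)"
      by (rule fl(2)[symmetric])
    finally show ?thesis .
  qed
  then show "?c * ?P \<le> (\<integral>x. indicator (ball 0 \<rho>) (x::'a) * bump_lap s x \<partial>lborel)"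
    by (intro LIMSEQ_le_const[OF bump_lap_trunc_flux_tendsto[OF s_pos s_less]]) auto
qed

text \<open>Exterior points z have bump value 0 since \<rho> \<ge> 2, so only x in the unit ball
  gives a positive contribution. There |z| \<le> 2|x - z|, and the flux is bounded by the mass of
  the bump times the tail of the kernel beyond \<rho>.\<close>

lemma bump_lap_flux_upper:
  fixes \<rho> :: real
  assumes \<rho>: "2 \<le> \<rho>"
  defines "\<sigma> \<equiv> real DIM('a) + 2 * s" and "\<omega> \<equiv> unit_ball_vol DIM('a)"
  shows "(\<integral>x. indicator (ball 0 \<rho>) (x::'a::euclidean_space) * bump_lap s x \<partial>lborel)
    \<le> 2 powr \<sigma> * (real DIM('a) * \<omega> / (2 * s) * \<rho> powr (- 2 * s)) * \<omega>"
proof -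
  let ?D = "real DIM('a) * \<omega> / (2 * s) * \<rho> powr (- 2 * s)"
  let ?c = "2 powr \<sigma> * ?D"
  have c: "0 \<le> ?c" using s_pos by (auto simp: \<omega>_def)
  have "(\<integral>x. indicator (ball 0 \<rho>) (x::'a) * bump_lap_trunc s (1 / Suc k) x \<partial>lborel) \<le> ?c * \<omega>" for k
  proof -
    let ?\<delta> = "1 / real (Suc k)"
    have \<delta>: "0 < ?\<delta>" "?\<delta> \<le> 1" by auto
    note fl = bump_lap_trunc_flux[OF s_pos s_less \<delta>(1), where \<rho>=\<rho> and 'a='a]
    note fl(2)
    also have "(\<integral>x. indicator (ball 0 \<rho>) (x::'a) *
        (\<integral>z. indicator (- ball 0 \<rho>) z * ((std_bump x - std_bump z) * trunc_kernel s ?\<delta> (x - z)) \<partial>lborel) \<partial>lborel)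
      \<le> (\<integral>x. std_bump (x::'a) * ?c \<partial>lborel)"
    proof (rule integral_mono[OF fl(1)])
      show "integrable lborel (\<lambda>x::'a. std_bump x * ?c)"
        by (intro integrable_mult_left integrable_std_bump)
      fix x :: 'a
      have "(\<integral>z. indicator (- ball 0 \<rho>) z * ((std_bump x - std_bump z) * trunc_kernel s ?\<delta> (x - z)) \<partial>lborel)
          \<le> (\<integral>z. (std_bump x * 2 powr \<sigma>) * trunc_kernel s \<rho> (z::'a) \<partial>lborel)"
      proof (rule integral_mono)
        show "integrable lborel (\<lambda>z. (std_bump x * 2 powr \<sigma>) * trunc_kernel s \<rho> z)"
          using \<rho> by (intro integrable_mult_right integrable_trunc_kernel s_pos s_less) auto
        show "integrable lborel (\<lambda>z. indicator (- ball 0 \<rho>) z * ((std_bump x - std_bump z) * trunc_kernel s ?\<delta> (x - z)))"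
          by (intro integrable_indicator_times
              integrable_std_bump_diff_trunc[OF s_pos s_less \<delta>(1)]) auto
        fix z :: 'a
        show "indicator (- ball 0 \<rho>) z * ((std_bump x - std_bump z) * trunc_kernel s ?\<delta> (x - z))
            \<le> (std_bump x * 2 powr \<sigma>) * trunc_kernel s \<rho> z"
        proof (cases "z \<in> ball 0 \<rho> \<or> 1 \<le> norm x")
          case True
          then show ?thesis
          proof
            assume "z \<in> ball 0 \<rho>"
            then show ?thesis by (simp add: std_bump_bounds)
          next
            assume "1 \<le> norm x"
            then show ?thesis
              by (auto simp: indicator_def std_bump_eq_0 std_bump_bounds mult_le_0_iff)
          qed
        next
          case False
          then have z: "\<rho> \<le> norm z" "norm x < 1" by auto
          have "norm z \<le> 2 * norm (x - z)"
            using norm_triangle_ineq3[of x z] z \<rho> by auto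
          then have "1 / norm (x - z) powr \<sigma> \<le> 2 powr \<sigma> / norm z powr \<sigma>"
            using z \<rho> s_pos by (intro inverse_powr_scale_le) (auto simp: \<sigma>_def)
          then have "trunc_kernel s ?\<delta> (x - z) \<le> 2 powr \<sigma> * trunc_kernel s \<rho> z"
            using z(1) order_trans[OF trunc_kernel_le[of s ?\<delta> "x - z"]]
            by (simp add: trunc_kernel_def[of s \<rho>] frac_kernel_def \<sigma>_def)
          then have "std_bump x * trunc_kernel s ?\<delta> (x - z) \<le> std_bump x * (2 powr \<sigma> * trunc_kernel s \<rho> z)"
            by (intro mult_left_mono std_bump_bounds)
          then show ?thesis using False z \<rho> by (simp add: std_bump_eq_0 mult.assoc)
        qed
      qed
      also have "\<dots> = std_bump x * ?c"
        using \<rho> by (simp add: integral_trunc_kernel[OF s_pos s_less] \<omega>_def)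
      finally have le: "(\<integral>z. indicator (- ball 0 \<rho>) z * ((std_bump x - std_bump z) * trunc_kernel s ?\<delta> (x - z)) \<partial>lborel)
          \<le> std_bump x * ?c" .
      have "0 \<le> std_bump x * ?c" by (rule mult_nonneg_nonneg[OF std_bump_bounds(1) c])
      with le show "indicator (ball 0 \<rho>) x *
        (\<integral>z. indicator (- ball 0 \<rho>) z * ((std_bump x - std_bump z) * trunc_kernel s ?\<delta> (x - z)) \<partial>lborel)
        \<le> std_bump x * ?c"
        by (cases "x \<in> ball 0 \<rho>") auto
    qed
    also have "\<dots> = (\<integral>x. std_bump (x::'a) \<partial>lborel) * ?c"
      by (rule integral_mult_left_zero)
    also have "\<dots> \<le> \<omega> * ?c"
      by (rule mult_right_mono[OF _ c]) (simp add: \<omega>_def integral_std_bump_le)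
    finally show ?thesis by (simp add: mult.commute)
  qed
  then show ?thesis
    by (intro LIMSEQ_le_const2[OF bump_lap_trunc_flux_tendsto[OF s_pos s_less]]) auto
qed

lemma flux_kernel_lower:
  obtains c where "0 < c" "\<And>x::'a::euclidean_space. x \<noteq> 0 \<Longrightarrow> c * frac_weight s x \<le> flux_kernel s x"
proof
  let ?n = "DIM('a)"
  define \<sigma> where "\<sigma> = real ?n + 2 * s"
  define \<omega> where "\<omega> = unit_ball_vol ?n"
  define c where "c = \<omega> * exp (- 2) * \<omega> / (5 powr \<sigma> * 2 ^ ?n)"
  have \<omega>: "\<omega> > 0" by (simp add: \<omega>_def)
  show "0 < c" using \<omega> by (simp add: c_def)
  fix x :: 'a assume x: "x \<noteq> 0"
  define \<rho> where "\<rho> = norm x"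
  define m where "m = max \<rho> 1"
  have \<rho>: "0 < \<rho>" using x by (simp add: \<rho>_def)
  \<comment> \<open>The identity \<open>m * min \<rho> 1 = \<rho>\<close> makes the powers in the
    flux bound cancel exactly against the division by \<rho>^n.\<close>
  have m: "1 \<le> m" "m \<le> 1 + \<rho>" "m * min \<rho> 1 = \<rho>" using \<rho> by (auto simp: m_def max_def min_def)
  have "m powr \<sigma> \<le> (1 + \<rho>) powr \<sigma>" using m s_pos by (intro powr_mono2) (auto simp: \<sigma>_def)
  then have "c * frac_weight s x \<le> c / m powr \<sigma>"
    using m \<open>0 < c\<close> unfolding frac_weight_def \<rho>_def[symmetric] \<sigma>_def[symmetric]
    by (auto intro!: divide_left_mono mult_pos_pos)
  also have "\<dots> = (\<omega> * m ^ ?n / (5 * m) powr \<sigma> * (exp (- 2) * \<omega> * (min \<rho> 1 / 2) ^ ?n)) / \<rho> ^ ?n"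
  proof -
    have "\<rho> ^ ?n = m ^ ?n * min \<rho> 1 ^ ?n" using m(3) by (metis power_mult_distrib)
    moreover have "min \<rho> 1 ^ ?n \<noteq> 0" using \<rho> by auto
    moreover have "(5 * m) powr \<sigma> = 5 powr \<sigma> * m powr \<sigma>" using m by (simp add: powr_mult)
    ultimately show ?thesis using m
      by (simp add: c_def power_divide mult_ac)
  qed
  also have "\<dots> \<le> flux_kernel s x"
    unfolding flux_kernel_def \<rho>_def[symmetric]
    using bump_lap_flux_lower[OF \<rho>, where 'a='a] \<rho>
    by (intro divide_right_mono) (auto simp: m_def \<sigma>_def \<omega>_def)
  finally show "c * frac_weight s x \<le> flux_kernel s x" .
qed

lemma flux_kernel_upper:
  obtains C where "0 < C" "\<And>x::'a::euclidean_space. flux_kernel s x \<le> C * frac_weight s x"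
proof
  let ?n = "DIM('a)"
  define \<sigma> where "\<sigma> = real ?n + 2 * s"
  define \<omega> where "\<omega> = unit_ball_vol ?n"
  define C0 where "C0 = \<bar>bump_lap_const s TYPE('a)\<bar>"
  define C1 where "C1 = 2 powr \<sigma> * (real ?n * \<omega> / (2 * s)) * \<omega>"
  have \<omega>: "\<omega> > 0" by (simp add: \<omega>_def)
  have C: "0 \<le> C0" "0 < C1" using \<omega> s_pos by (auto simp: C0_def C1_def intro!: mult_pos_pos divide_pos_pos)
  have \<sigma>: "0 < \<sigma>" using s_pos by (simp add: \<sigma>_def)
  show C': "0 < 3 powr \<sigma> * (C0 * \<omega> + C1)" using C \<omega> by (intro mult_pos_pos add_nonneg_pos mult_nonneg_nonneg) auto
  fix x :: 'a
  define \<rho> where "\<rho> = norm x"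
  have w: "frac_weight s x = 1 / (1 + \<rho>) powr \<sigma>" by (simp add: frac_weight_def \<rho>_def \<sigma>_def)
  have \<rho>: "0 \<le> \<rho>" by (simp add: \<rho>_def)
  show "flux_kernel s x \<le> 3 powr \<sigma> * (C0 * \<omega> + C1) * frac_weight s x"
  proof (cases "\<rho> < 2")
    case True
    have "(\<integral>z. indicator (ball 0 \<rho>) (z::'a) * bump_lap s z \<partial>lborel)
        \<le> (\<integral>z. indicator (ball 0 \<rho>) (z::'a) * C0 \<partial>lborel)"
    proof (rule integral_mono[OF integrable_ball_bump_lap])
      show "integrable lborel (\<lambda>x::'a. indicator (ball 0 \<rho>) x * C0)"
        by (intro integrable_mult_left integrable_indicator_ball)
      fix z :: 'a
      show "indicator (ball 0 \<rho>) z * bump_lap s z \<le> indicator (ball 0 \<rho>) z * C0"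
        using bump_lap_bounded(1)[OF s_pos s_less, of z] by (intro mult_left_mono) (auto simp: C0_def)
    qed
    also have "\<dots> = C0 * \<omega> * \<rho> ^ ?n" using \<rho> by (simp add: content_ball \<omega>_def)
    finally have "flux_kernel s x \<le> C0 * \<omega> * \<rho> ^ ?n / \<rho> ^ ?n"
      unfolding flux_kernel_def \<rho>_def[symmetric] using \<rho> by (intro divide_right_mono) auto
    \<comment> \<open>For \<rho> > 0 the volume of the ball cancels the denominator; at \<rho> = 0
      the quotient is 0 by convention, as n \<ge> 1.\<close>
    also have "\<dots> \<le> (C0 * \<omega> + C1) * 1" using C \<omega> by (cases "\<rho> = 0") auto
    also have "\<dots> \<le> (C0 * \<omega> + C1) * (3 powr \<sigma> * frac_weight s x)"
    proof (rule mult_left_mono)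
      have "1 / 1 powr \<sigma> \<le> 3 powr \<sigma> / (1 + \<rho>) powr \<sigma>"
        using True \<rho> \<sigma> by (intro inverse_powr_scale_le) auto
      then show "1 \<le> 3 powr \<sigma> * frac_weight s x" by (simp add: w)
    qed (use C \<omega> in auto)
    finally show ?thesis by (simp add: mult_ac)
  next
    case False
    have "(\<integral>z. indicator (ball 0 \<rho>) (z::'a) * bump_lap s z \<partial>lborel) \<le> C1 * \<rho> powr (- 2 * s)"
      using bump_lap_flux_upper[of \<rho>, where 'a='a] False by (simp add: C1_def \<sigma>_def \<omega>_def mult_ac)
    then have "flux_kernel s x \<le> C1 * \<rho> powr (- 2 * s) / \<rho> ^ ?n"
      unfolding flux_kernel_def \<rho>_def[symmetric] using \<rho> by (intro divide_right_mono) auto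
    also have "\<dots> = C1 * (1 / \<rho> powr \<sigma>)"
    proof -
      have "\<rho> powr (- 2 * s) * \<rho> powr \<sigma> = \<rho> powr real ?n"
        by (simp add: powr_add[symmetric] \<sigma>_def)
      then have "\<rho> powr (- 2 * s) * \<rho> powr \<sigma> = \<rho> ^ ?n"
        using False by (simp add: powr_realpow)
      then show ?thesis using False by (simp add: field_simps)
    qed
    also have "\<dots> \<le> C1 * (3 powr \<sigma> / (1 + \<rho>) powr \<sigma>)"
      using C False \<sigma> by (intro mult_left_mono inverse_powr_scale_le) auto
    also have "\<dots> = C1 * (3 powr \<sigma> * frac_weight s x)" by (simp add: w)
    also have "\<dots> \<le> (C0 * \<omega> + C1) * (3 powr \<sigma> * frac_weight s x)"
      using C \<omega> frac_weight_pos[of s x] by (intro mult_right_mono) auto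
    finally show ?thesis by (simp add: mult_ac)
  qed
qed

lemma flux_kernel_nonneg: "0 \<le> flux_kernel s (x::'a::euclidean_space)"
proof (cases "x = 0")
  case False
  obtain c where "0 < c" "\<And>x::'a. x \<noteq> 0 \<Longrightarrow> c * frac_weight s x \<le> flux_kernel s x"
    using flux_kernel_lower[where 'a='a] by blast
  with False frac_weight_pos[of s x] show ?thesis
    by (meson less_imp_le mult_pos_pos order_trans)
qed (simp add: flux_kernel_def)

text \<open>The ball depends on x, so its indicator is rewritten as a comparison of norms that is
  jointly measurable in x and z.\<close>

lemma borel_measurable_flux_kernel [measurable]:
  "(flux_kernel s :: 'a::euclidean_space \<Rightarrow> real) \<in> borel_measurable borel"
proof -
  have "(\<lambda>x::'a. (\<integral>z. (if norm z < norm x then 1 else 0) * bump_lap s (z::'a) \<partial>lborel) / norm x ^ DIM('a)) \<in> borel_measurable borel"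
    by measurable
  also have "(\<lambda>x::'a. (\<integral>z. (if norm z < norm x then 1 else 0) * bump_lap s (z::'a) \<partial>lborel) / norm x ^ DIM('a)) = flux_kernel s"
    by (auto simp: flux_kernel_def fun_eq_iff indicator_def intro!: Bochner_Integration.integral_cong arg_cong2[where f="(/)"])
  finally show ?thesis .
qed

text \<open>Multiplying by |x|^n turns the left side into the flux at b|x| minus the flux at a|x|,
  an integral of h over a shell. Polar coordinates and the substitution t = \<mu>|x| give the right
  side. No differentiability of the flux enters.\<close>

lemma flux_kernel_scale_diff:
  fixes x :: "'a::euclidean_space"
  assumes x: "x \<noteq> 0" and ab: "0 < a" "a \<le> b"
  shows "b ^ DIM('a) * flux_kernel s (b *\<^sub>R x) - a ^ DIM('a) * flux_kernel s (a *\<^sub>R x)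
    = DIM('a) * unit_ball_vol DIM('a) * (\<integral>\<mu>. indicator {a..<b} \<mu> * \<mu> ^ (DIM('a) - 1) * bump_lap s (\<mu> *\<^sub>R x) \<partial>lborel)"
proof -
  let ?n = "DIM('a)" and ?\<rho> = "norm x"
  have \<rho>: "?\<rho> > 0" using x by simp
  \<comment> \<open>The radial profile of h, read off along the ray through
    \<open>x\<close>.\<close>
  define \<eta> where "\<eta> t = bump_lap s ((t / ?\<rho>) *\<^sub>R x)" for t
  have [measurable]: "\<eta> \<in> borel_measurable borel" unfolding \<eta>_def by measurable
  have \<eta>: "bump_lap s z = \<eta> (norm z)" for z :: 'a
    unfolding \<eta>_def using x by (intro bump_lap_radial[OF s_pos s_less]) auto
  have K: "b ^ ?n * flux_kernel s (b *\<^sub>R x) = (\<integral>z. indicator (ball 0 (b * ?\<rho>)) (z::'a) * bump_lap s z \<partial>lborel) / ?\<rho> ^ ?n"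
    if "0 < b" for b
    using that by (simp add: flux_kernel_def power_mult_distrib)
  have "b ^ ?n * flux_kernel s (b *\<^sub>R x) - a ^ ?n * flux_kernel s (a *\<^sub>R x)
      = (\<integral>z. indicator (ball 0 (b * ?\<rho>)) (z::'a) * bump_lap s z - indicator (ball 0 (a * ?\<rho>)) z * bump_lap s z \<partial>lborel) / ?\<rho> ^ ?n"
    using ab by (subst Bochner_Integration.integral_diff) (auto simp: K diff_divide_distrib intro: integrable_ball_bump_lap)
  also have "(\<integral>z. indicator (ball 0 (b * ?\<rho>)) (z::'a) * bump_lap s z - indicator (ball 0 (a * ?\<rho>)) z * bump_lap s z \<partial>lborel)
      = (\<integral>z. indicator {a * ?\<rho>..<b * ?\<rho>} (norm (z::'a)) * \<eta> (norm z) \<partial>lborel)"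
  proof (rule Bochner_Integration.integral_cong[OF refl])
    fix z :: 'a
    have "a * ?\<rho> \<le> b * ?\<rho>" using ab \<rho> by simp
    then show "indicator (ball 0 (b * ?\<rho>)) z * bump_lap s z - indicator (ball 0 (a * ?\<rho>)) z * bump_lap s z
        = indicator {a * ?\<rho>..<b * ?\<rho>} (norm z) * \<eta> (norm z)"
      by (auto simp: indicator_def \<eta>)
  qed
  also have "\<dots> = real ?n * unit_ball_vol ?n * (\<integral>t. indicator {0..} t * t ^ (?n - 1) * (indicator {a * ?\<rho>..<b * ?\<rho>} t * \<eta> t) \<partial>lborel)"
    by (rule integral_radial) measurable
  also have "(\<integral>t. indicator {0..} t * t ^ (?n - 1) * (indicator {a * ?\<rho>..<b * ?\<rho>} t * \<eta> t) \<partial>lborel)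
      = ?\<rho> * (\<integral>t. indicator {0..} (?\<rho> * t) * (?\<rho> * t) ^ (?n - 1) * (indicator {a * ?\<rho>..<b * ?\<rho>} (?\<rho> * t) * \<eta> (?\<rho> * t)) \<partial>lborel)"
    using lborel_integral_affine[of "\<lambda>t. indicator {0..} t * t ^ (?n - 1) * (indicator {a * ?\<rho>..<b * ?\<rho>} t * \<eta> t)" ?\<rho> 0] \<rho>
    by simp
  also have "\<dots> = (\<integral>t. ?\<rho> ^ ?n * (indicator {a..<b} t * t ^ (?n - 1) * bump_lap s (t *\<^sub>R x)) \<partial>lborel)"
    unfolding integral_mult_right_zero[symmetric]
  proof (rule Bochner_Integration.integral_cong[OF refl])
    fix t :: real
    have "?\<rho> * ?\<rho> ^ (?n - 1) = ?\<rho> ^ ?n" by (simp flip: power_Suc)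
    moreover have "\<eta> (?\<rho> * t) = bump_lap s (t *\<^sub>R x)" using \<rho> by (simp add: \<eta>_def)
    ultimately show "?\<rho> * (indicator {0..} (?\<rho> * t) * (?\<rho> * t) ^ (?n - 1) * (indicator {a * ?\<rho>..<b * ?\<rho>} (?\<rho> * t) * \<eta> (?\<rho> * t)))
        = ?\<rho> ^ ?n * (indicator {a..<b} t * t ^ (?n - 1) * bump_lap s (t *\<^sub>R x))"
      using \<rho> ab by (auto simp: indicator_def power_mult_distrib mult.commute[of ?\<rho>] zero_le_mult_iff)
  qed
  finally show ?thesis using \<rho> by simp
qed

end

section \<open>Averages of solutions\<close>

lemma integrable_times_pair:
  fixes u :: "'a::euclidean_space \<Rightarrow> real" and v :: "'b::euclidean_space \<Rightarrow> real"
  assumes u: "integrable lborel u" and v: "integrable lborel v"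
  shows "integrable (lborel \<Otimes>\<^sub>M lborel) (\<lambda>(x, y). u x * v y)"
proof (rule lborel_pair.Fubini_integrable)
  have [measurable]: "u \<in> borel_measurable borel" "v \<in> borel_measurable borel"
    using u v by (auto dest: borel_measurable_integrable)
  show "(\<lambda>(x, y). u x * v y) \<in> borel_measurable (lborel \<Otimes>\<^sub>M lborel)" by measurable
  show "integrable lborel (\<lambda>x. \<integral>y. norm (case (x, y) of (x, y) \<Rightarrow> u x * v y) \<partial>lborel)"
    using u by (simp add: abs_mult)
  show "AE x in lborel. integrable lborel (\<lambda>y. case (x, y) of (x, y) \<Rightarrow> u x * v y)"
    using v by (intro AE_I2) simp
qed

text \<open>Expanding (1 + |a| + 1/b)(1 + b|y - a|), the term 1/b times b|y - a| supplies |y - a|,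
  and the sum dominates 1 + |y|. The factor decreases in \<open>b\<close>, so it is uniform over
  scales bounded below.\<close>

lemma frac_weight_shift:
  fixes a y :: "'a::euclidean_space"
  assumes s: "0 < s" and b: "0 < b"
  shows "frac_weight s (b *\<^sub>R (y - a)) \<le> (1 + norm a + 1 / b) powr (real DIM('a) + 2 * s) * frac_weight s y"
proof -
  have "(1 + norm a + 1 / b) * (1 + b * norm (y - a))
      = 1 + norm a + 1 / b + b * norm (y - a) + norm a * (b * norm (y - a)) + norm (y - a)"
    using b by (simp add: field_simps)
  moreover have "0 \<le> b * norm (y - a)" "0 \<le> norm a * (b * norm (y - a))" "0 \<le> 1 / b" using b by auto
  moreover have "norm y \<le> norm a + norm (y - a)" by (metis norm_triangle_sub)
  ultimately have "1 + norm y \<le> (1 + norm a + 1 / b) * (1 + b * norm (y - a))" by linarith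
  then show ?thesis
    unfolding frac_weight_def using s b
    by (simp add: inverse_powr_scale_le add_pos_nonneg add_nonneg_pos divide_inverse[of 1, symmetric])
qed

lemma frac_weight_comparable:
  fixes x y :: "'a::euclidean_space"
  assumes s: "0 < s" and "norm (x - y) \<le> 2"
  shows "frac_weight s x \<le> 3 powr (real DIM('a) + 2 * s) * frac_weight s y"
proof -
  have "norm y \<le> norm x + 2" using assms(2) norm_triangle_ineq3[of x y] by linarith
  then have "1 + norm y \<le> 3 * (1 + norm x)" by (simp add: algebra_simps) (smt (verit) norm_ge_zero)
  then have "1 / (1 + norm x) powr (real DIM('a) + 2 * s)
      \<le> 3 powr (real DIM('a) + 2 * s) / (1 + norm y) powr (real DIM('a) + 2 * s)"
    using s by (intro inverse_powr_scale_le) (auto intro: add_pos_nonneg)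
  then show ?thesis by (simp add: frac_weight_def)
qed

lemma frac_laplacian_const_pos: "0 < s \<Longrightarrow> s < 1 \<Longrightarrow> 0 < frac_laplacian_const n s"
  unfolding frac_laplacian_const_def
  by (intro divide_pos_pos mult_pos_pos Gamma_real_pos) (auto intro: add_nonneg_pos)

section \<open>Testing the equation with rescaled bumps; the mass of the kernel\<close>

context
  fixes s :: real
  assumes s_pos: "0 < s" and s_less: "s < 1"
begin

text \<open>Under z = \<mu>(\<xi> - a) the homogeneity of the kernel and the Jacobian together leave
  \<mu>^(2s), and the truncation radius is multiplied by \<mu>.\<close>

lemma trunc_frac_laplacian_bump:
  fixes a y :: "'a::euclidean_space"
  assumes \<mu>: "0 < \<mu>" and \<epsilon>: "0 < \<epsilon>"
  defines "\<phi> \<equiv> \<lambda>y. std_bump (\<mu> *\<^sub>R (y - a))"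
  shows "(LINT \<xi>:- ball y \<epsilon>|lebesgue. (\<phi> y - \<phi> \<xi>) / norm (y - \<xi>) powr (real DIM('a) + 2 * s))
    = \<mu> powr (2 * s) * bump_lap_trunc s (\<mu> * \<epsilon>) (\<mu> *\<^sub>R (y - a))"
proof -
  let ?\<sigma> = "real DIM('a) + 2 * s" and ?x = "\<mu> *\<^sub>R (y - a)"
  let ?g = "\<lambda>z. (std_bump ?x - std_bump z) * trunc_kernel s (\<mu> * \<epsilon>) (?x - z)"
  have [measurable]: "\<phi> \<in> borel_measurable borel" unfolding \<phi>_def by measurable
  have "(LINT \<xi>:- ball y \<epsilon>|lebesgue. (\<phi> y - \<phi> \<xi>) / norm (y - \<xi>) powr ?\<sigma>)
      = (\<integral>\<xi>. (\<phi> y - \<phi> \<xi>) * trunc_kernel s \<epsilon> (y - \<xi>) \<partial>lebesgue)"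
    unfolding set_lebesgue_integral_def
    by (rule Bochner_Integration.integral_cong)
      (auto simp: trunc_kernel_def frac_kernel_def indicator_def dist_norm)
  also have "\<dots> = (\<integral>\<xi>. (\<phi> y - \<phi> \<xi>) * trunc_kernel s \<epsilon> (y - \<xi>) \<partial>lborel)"
    by (rule integral_completion) measurable
  also have "\<dots> = \<mu> powr (2 * s) * (\<mu> ^ DIM('a) * (\<integral>\<xi>. ?g ((- \<mu>) *\<^sub>R a + \<mu> *\<^sub>R \<xi>) \<partial>lborel))"
  proof -
    have "?g ((- \<mu>) *\<^sub>R a + \<mu> *\<^sub>R \<xi>) = (1 / \<mu> powr ?\<sigma>) * ((\<phi> y - \<phi> \<xi>) * trunc_kernel s \<epsilon> (y - \<xi>))" for \<xi>
    proof -
      have 1: "(- \<mu>) *\<^sub>R a + \<mu> *\<^sub>R \<xi> = \<mu> *\<^sub>R (\<xi> - a)" by (simp add: algebra_simps)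
      have 2: "?x - \<mu> *\<^sub>R (\<xi> - a) = \<mu> *\<^sub>R (y - \<xi>)" by (simp add: algebra_simps)
      have 3: "trunc_kernel s (\<mu> * \<epsilon>) (\<mu> *\<^sub>R (y - \<xi>)) = (1 / \<mu> powr ?\<sigma>) * trunc_kernel s \<epsilon> (y - \<xi>)"
        using \<mu> by (simp add: trunc_kernel_def frac_kernel_def powr_mult indicator_def)
      show ?thesis unfolding 1 2 3 \<phi>_def by simp
    qed
    moreover have "\<mu> powr (2 * s) * \<mu> ^ DIM('a) = \<mu> powr ?\<sigma>"
      using \<mu> by (simp add: powr_add powr_realpow)
    ultimately show ?thesis using \<mu> by (simp add: mult.assoc[symmetric])
  qed
  also have "\<mu> ^ DIM('a) * (\<integral>\<xi>. ?g ((- \<mu>) *\<^sub>R a + \<mu> *\<^sub>R \<xi>) \<partial>lborel) = (\<integral>z. ?g z \<partial>lborel)"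
    using lborel_integral_affine[of ?g \<mu> "(- \<mu>) *\<^sub>R a"] \<mu> by simp
  also have "\<dots> = bump_lap_trunc s (\<mu> * \<epsilon>) ?x"
    using \<mu> \<epsilon> by (simp add: bump_lap_trunc_eq[OF s_pos s_less])
  finally show ?thesis .
qed

lemma frac_laplacian_bump:
  fixes a y :: "'a::euclidean_space"
  assumes \<mu>: "0 < \<mu>"
  shows "frac_laplacian s (\<lambda>y. std_bump (\<mu> *\<^sub>R (y - a))) y
    = frac_laplacian_const DIM('a) s * \<mu> powr (2 * s) * bump_lap s (\<mu> *\<^sub>R (y - a))"
proof -
  let ?\<phi> = "\<lambda>y. std_bump (\<mu> *\<^sub>R (y - a))"
  have "filterlim (\<lambda>\<epsilon>. \<mu> * \<epsilon>) (at_right 0) (at_right 0)"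
    using \<mu> by real_asymp
  then have "((\<lambda>\<epsilon>. \<mu> powr (2 * s) * bump_lap_trunc s (\<mu> * \<epsilon>) (\<mu> *\<^sub>R (y - a)))
      \<longlongrightarrow> \<mu> powr (2 * s) * bump_lap s (\<mu> *\<^sub>R (y - a))) (at_right 0)"
    by (intro tendsto_mult_left filterlim_compose[OF bump_lap_trunc_tendsto[OF s_pos s_less]])
  then have "((\<lambda>\<epsilon>. LINT \<xi>:- ball y \<epsilon>|lebesgue. (?\<phi> y - ?\<phi> \<xi>) / norm (y - \<xi>) powr (real DIM('a) + 2 * s))
      \<longlongrightarrow> \<mu> powr (2 * s) * bump_lap s (\<mu> *\<^sub>R (y - a))) (at_right 0)"
    by (rule tendsto_cong[THEN iffD1, rotated])
      (auto simp: trunc_frac_laplacian_bump[OF \<mu>] eventually_at_right_field intro!: exI[of _ 1])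
  then show ?thesis
    unfolding frac_laplacian_def by (subst tendsto_Lim) auto
qed

text \<open>The positive constants are divided out, and \<open>f\<close> is replaced by a Borel
  version so that the later Fubini arguments can work with \<open>lborel\<close>.\<close>

lemma frac_laplacian_zero_in_bump:
  fixes f g :: "'a::euclidean_space \<Rightarrow> real"
  assumes zero: "frac_laplacian_zero_in s f U"
    and fg: "AE x in lebesgue. f x = g x" and f: "f \<in> borel_measurable lebesgue"
    and g [measurable]: "g \<in> borel_measurable borel"
    and \<mu>: "0 < \<mu>" and U: "cball a (1 / \<mu>) \<subseteq> U"
  shows "(\<integral>y. g y * bump_lap s (\<mu> *\<^sub>R (y - a)) \<partial>lborel) = 0"
proof -
  let ?c = "frac_laplacian_const DIM('a) s * \<mu> powr (2 * s)"
  have m [measurable]: "(\<lambda>y. bump_lap s (\<mu> *\<^sub>R (y - a))) \<in> borel_measurable borel" by measurable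
  have ml: "(\<lambda>y. bump_lap s (\<mu> *\<^sub>R (y - a))) \<in> borel_measurable lebesgue" "g \<in> borel_measurable lebesgue"
    using m g by (auto intro!: measurable_completion)
  have "0 = (\<integral>y. f y * frac_laplacian s (\<lambda>y. std_bump (\<mu> *\<^sub>R (y - a))) y \<partial>lebesgue)"
    using zero std_bump_test_function[OF \<mu> U] unfolding frac_laplacian_zero_in_def by auto
  also have "\<dots> = (\<integral>y. ?c * (f y * bump_lap s (\<mu> *\<^sub>R (y - a))) \<partial>lebesgue)"
    by (simp only: frac_laplacian_bump[OF \<mu>] mult.left_commute mult.assoc)
  also have "\<dots> = ?c * (\<integral>y. f y * bump_lap s (\<mu> *\<^sub>R (y - a)) \<partial>lebesgue)"
    by (rule integral_mult_right_zero)
  also have "(\<integral>y. f y * bump_lap s (\<mu> *\<^sub>R (y - a)) \<partial>lebesgue) = (\<integral>y. g y * bump_lap s (\<mu> *\<^sub>R (y - a)) \<partial>lebesgue)"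
    using fg by (intro integral_cong_AE borel_measurable_times f ml) (auto elim: eventually_mono)
  also have "\<dots> = (\<integral>y. g y * bump_lap s (\<mu> *\<^sub>R (y - a)) \<partial>lborel)"
    by (rule integral_completion) measurable
  finally show ?thesis
    using frac_laplacian_const_pos[OF s_pos s_less, of "DIM('a)"] \<mu> by simp
qed

text \<open>The mass is the multiple of \<open>f(a)\<close> that survives at large scales and is
  divided out at the end, so it must be finite and nonzero.\<close>

lemma integrable_flux_kernel: "integrable lborel (flux_kernel s :: 'a::euclidean_space \<Rightarrow> real)"
  and integral_flux_kernel_pos: "0 < (\<integral>x. flux_kernel s (x::'a) \<partial>lborel)"
proof -
  note [measurable] = borel_measurable_flux_kernel[OF s_pos s_less]
  obtain C where C: "0 < C" "\<And>x::'a. flux_kernel s x \<le> C * frac_weight s x"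
    using flux_kernel_upper[OF s_pos s_less, where 'a='a] by blast
  obtain c where c: "0 < c" "\<And>x::'a. x \<noteq> 0 \<Longrightarrow> c * frac_weight s x \<le> flux_kernel s x"
    using flux_kernel_lower[OF s_pos s_less, where 'a='a] by blast
  note w = integrable_frac_weight[OF s_pos s_less, where 'a='a]
  show i: "integrable lborel (flux_kernel s :: 'a \<Rightarrow> real)"
    by (rule Bochner_Integration.integrable_bound[OF integrable_mult_right[OF w, of C]])
      (use C(2) in \<open>auto simp: abs_of_nonneg flux_kernel_nonneg[OF s_pos s_less] intro!: order_trans[OF _ abs_ge_self]\<close>)
  have "0 \<noteq> (\<integral>x. frac_weight s (x::'a) \<partial>lborel)"
  proof
    assume "0 = (\<integral>x. frac_weight s (x::'a) \<partial>lborel)"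
    then have "AE x in lborel. frac_weight s (x::'a) = 0"
      using integral_nonneg_eq_0_iff_AE[OF w AE_I2[OF less_imp_le[OF frac_weight_pos]]] by simp
    then have "AE x in (lborel :: 'a measure). False"
      by eventually_elim (metis frac_weight_pos less_irrefl)
    then show False by (simp add: eventually_False ae_filter_eq_bot_iff)
  qed
  moreover have "0 \<le> (\<integral>x. frac_weight s (x::'a) \<partial>lborel)"
    by (rule Bochner_Integration.integral_nonneg) (simp add: frac_weight_pos less_imp_le)
  ultimately have "0 < (\<integral>x. c * frac_weight s (x::'a) \<partial>lborel)" using c(1) by simp
  also have "\<dots> \<le> (\<integral>x. flux_kernel s (x::'a) \<partial>lborel)"
  proof (rule integral_mono_AE[OF integrable_mult_right[OF w] i])
    show "AE x in lborel. c * frac_weight s (x::'a) \<le> flux_kernel s x"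
      using AE_lborel_singleton[of "0::'a"] by eventually_elim (rule c(2))
  qed
  finally show "0 < (\<integral>x. flux_kernel s (x::'a) \<partial>lborel)" .
qed

end

section \<open>Averages of a nonnegative Borel representative g\<close>

context
  fixes s :: real and g :: "'a::euclidean_space \<Rightarrow> real"
  assumes s_pos: "0 < s" and s_less: "s < 1"
    and g [measurable]: "g \<in> borel_measurable borel"
    and g_nonneg: "\<And>y. 0 \<le> g y"
    and g_int: "integrable lborel (\<lambda>y. g y * frac_weight s y)"
begin

private lemma flux_measurable [measurable]: "(flux_kernel s :: 'a \<Rightarrow> real) \<in> borel_measurable borel"
  by (rule borel_measurable_flux_kernel[OF s_pos s_less])

private lemma flux_nonneg: "0 \<le> flux_kernel s (x :: 'a)"
  by (rule flux_kernel_nonneg[OF s_pos s_less])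

lemma flux_kernel_shift_le:
  obtains C where "0 < C" "\<And>x::'a. flux_kernel s x \<le> C * frac_weight s x"
    "\<And>b a (y::'a). 0 < b \<Longrightarrow> flux_kernel s (b *\<^sub>R (y - a))
      \<le> C * (1 + norm a + 1 / b) powr (real DIM('a) + 2 * s) * frac_weight s y"
proof -
  obtain C where C: "0 < C" "\<And>x::'a. flux_kernel s x \<le> C * frac_weight s x"
    using flux_kernel_upper[OF s_pos s_less, where 'a='a] by blast
  have "flux_kernel s (b *\<^sub>R (y - a)) \<le> C * (1 + norm a + 1 / b) powr (real DIM('a) + 2 * s) * frac_weight s y"
    if "0 < b" for b and a y :: 'a
  proof -
    have "flux_kernel s (b *\<^sub>R (y - a)) \<le> C * frac_weight s (b *\<^sub>R (y - a))" by (rule C)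
    also have "\<dots> \<le> C * ((1 + norm a + 1 / b) powr (real DIM('a) + 2 * s) * frac_weight s y)"
      using C that s_pos by (intro mult_left_mono frac_weight_shift) auto
    finally show ?thesis by (simp add: mult.assoc)
  qed
  with C show ?thesis using that by blast
qed

lemma integrable_flux_average:
  assumes "0 < b"
  shows "integrable lborel (\<lambda>y. g y * (b ^ DIM('a) * flux_kernel s (b *\<^sub>R (y - a))))"
proof -
  obtain C where C: "0 < C" "\<And>b a (y::'a). 0 < b \<Longrightarrow> flux_kernel s (b *\<^sub>R (y - a))
      \<le> C * (1 + norm a + 1 / b) powr (real DIM('a) + 2 * s) * frac_weight s y"
    using flux_kernel_shift_le by metis
  let ?D = "C * (1 + norm a + 1 / b) powr (real DIM('a) + 2 * s)"
  show ?thesis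
  proof (rule Bochner_Integration.integrable_bound)
    show "integrable lborel (\<lambda>y. b ^ DIM('a) * ?D * (g y * frac_weight s y))"
      by (intro integrable_mult_right g_int)
    show "AE y in lborel. norm (g y * (b ^ DIM('a) * flux_kernel s (b *\<^sub>R (y - a))))
        \<le> norm (b ^ DIM('a) * ?D * (g y * frac_weight s y))"
    proof (rule AE_I2)
      fix y :: 'a
      have "g y * (b ^ DIM('a) * flux_kernel s (b *\<^sub>R (y - a))) \<le> g y * (b ^ DIM('a) * (?D * frac_weight s y))"
        using assms by (intro mult_left_mono C g_nonneg) auto
      then show "norm (g y * (b ^ DIM('a) * flux_kernel s (b *\<^sub>R (y - a))))
          \<le> norm (b ^ DIM('a) * ?D * (g y * frac_weight s y))"
        using assms g_nonneg[of y] flux_nonneg[of "b *\<^sub>R (y - a)"]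
        by (simp add: abs_of_nonneg mult_ac)
    qed
  qed measurable
qed

text \<open>By \<open>flux_kernel_scale_diff\<close> the difference of the two averages is a double
  integral over y and \<mu> in [A, b). After Fubini the inner integral over y vanishes for each
  \<mu> by \<open>zero\<close>.\<close>

lemma flux_average_const:
  assumes Ab: "0 < A" "A \<le> b"
    and zero: "\<And>\<mu>. A \<le> \<mu> \<Longrightarrow> (\<integral>y. g y * bump_lap s (\<mu> *\<^sub>R (y - a)) \<partial>lborel) = 0"
  shows "(\<integral>y. g y * (b ^ DIM('a) * flux_kernel s (b *\<^sub>R (y - a))) \<partial>lborel)
    = (\<integral>y. g y * (A ^ DIM('a) * flux_kernel s (A *\<^sub>R (y - a))) \<partial>lborel)"
proof -
  let ?n = "DIM('a)"
  define G where "G y \<mu> = indicator {A..<b} \<mu> * \<mu> ^ (?n - 1) * (g y * bump_lap s (\<mu> *\<^sub>R (y - a)))" for y \<mu>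
  have [measurable]: "(\<lambda>(y, \<mu>). G y \<mu>) \<in> borel_measurable (borel \<Otimes>\<^sub>M borel)"
    unfolding G_def by measurable
  obtain C where C: "0 < C" "\<And>x::'a. \<bar>bump_lap s x\<bar> \<le> C * frac_weight s x"
    using bump_lap_le_weight[OF s_pos s_less, where 'a='a] by blast
  \<comment> \<open>The factor of \<open>frac_weight_shift\<close> decreases with the scale, so its
    value at \<open>A\<close> bounds it for all \<mu> \<ge> A.\<close>
  define D where "D = (1 + norm a + 1 / A) powr (real ?n + 2 * s)"
  have G_int: "integrable (lborel \<Otimes>\<^sub>M lborel) (\<lambda>(y, \<mu>). G y \<mu>)"
  proof (rule Bochner_Integration.integrable_bound)
    show "integrable (lborel \<Otimes>\<^sub>M lborel) (\<lambda>(y, \<mu>). (g y * frac_weight s y) * (indicator {A..<b} \<mu> * (b ^ (?n - 1) * (C * D))))"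
      by (intro integrable_times_pair g_int integrable_mult_left) (simp add: integrable_indicator_iff Ab)
    have "norm (G y \<mu>) \<le> (g y * frac_weight s y) * (indicator {A..<b} \<mu> * (b ^ (?n - 1) * (C * D)))" for y \<mu>
    proof (cases "\<mu> \<in> {A..<b}")
      case True
      then have \<mu>: "0 < \<mu>" "A \<le> \<mu>" "\<mu> \<le> b" using Ab by auto
      have "\<bar>bump_lap s (\<mu> *\<^sub>R (y - a))\<bar> \<le> C * frac_weight s (\<mu> *\<^sub>R (y - a))" by (rule C)
      also have "\<dots> \<le> C * ((1 + norm a + 1 / \<mu>) powr (real ?n + 2 * s) * frac_weight s y)"
        using C \<mu> s_pos by (intro mult_left_mono frac_weight_shift) auto
      also have "\<dots> \<le> C * (D * frac_weight s y)"
        unfolding D_def using C \<mu> Ab s_pos frac_weight_pos[of s y]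
        by (intro mult_left_mono mult_right_mono powr_mono2 add_left_mono frac_le) auto
      finally have "\<mu> ^ (?n - 1) * (g y * \<bar>bump_lap s (\<mu> *\<^sub>R (y - a))\<bar>)
          \<le> b ^ (?n - 1) * (g y * (C * (D * frac_weight s y)))"
        using \<mu> g_nonneg[of y] by (intro mult_mono power_mono mult_left_mono mult_nonneg_nonneg) auto
      then show ?thesis using True \<mu> g_nonneg[of y]
        by (simp add: G_def abs_mult abs_of_nonneg mult_ac)
    qed (simp add: G_def)
    then show "AE p in lborel \<Otimes>\<^sub>M lborel. norm (case p of (y, \<mu>) \<Rightarrow> G y \<mu>)
        \<le> norm (case p of (y, \<mu>) \<Rightarrow> (g y * frac_weight s y) * (indicator {A..<b} \<mu> * (b ^ (?n - 1) * (C * D))))"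
      by (intro AE_I2) (auto intro: order_trans[OF _ abs_ge_self])
  qed measurable
  have b: "0 < b" using Ab by simp
  let ?d = "\<lambda>y. g y * (b ^ ?n * flux_kernel s (b *\<^sub>R (y - a))) - g y * (A ^ ?n * flux_kernel s (A *\<^sub>R (y - a)))"
  have "(\<integral>y. g y * (b ^ ?n * flux_kernel s (b *\<^sub>R (y - a))) \<partial>lborel)
      - (\<integral>y. g y * (A ^ ?n * flux_kernel s (A *\<^sub>R (y - a))) \<partial>lborel) = (\<integral>y. ?d y \<partial>lborel)"
    by (rule Bochner_Integration.integral_diff[symmetric]) (intro integrable_flux_average Ab b)+
  also have "\<dots> = (\<integral>y. ?n * unit_ball_vol ?n * (\<integral>\<mu>. G y \<mu> \<partial>lborel) \<partial>lborel)"
  proof (rule integral_cong_AE)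
    show "AE y in lborel. ?d y = ?n * unit_ball_vol ?n * (\<integral>\<mu>. G y \<mu> \<partial>lborel)"
      using AE_lborel_singleton[of a]
    proof eventually_elim
      case (elim y)
      have "?d y = g y * (b ^ ?n * flux_kernel s (b *\<^sub>R (y - a)) - A ^ ?n * flux_kernel s (A *\<^sub>R (y - a)))"
        by (simp add: right_diff_distrib)
      also have "\<dots> = g y * (?n * unit_ball_vol ?n *
          (\<integral>\<mu>. indicator {A..<b} \<mu> * \<mu> ^ (?n - 1) * bump_lap s (\<mu> *\<^sub>R (y - a)) \<partial>lborel))"
        using elim Ab by (subst flux_kernel_scale_diff[OF s_pos s_less]) auto
      also have "\<dots> = ?n * unit_ball_vol ?n *
          (\<integral>\<mu>. g y * (indicator {A..<b} \<mu> * \<mu> ^ (?n - 1) * bump_lap s (\<mu> *\<^sub>R (y - a))) \<partial>lborel)"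
        by (simp only: integral_mult_right_zero mult.left_commute)
      finally show ?case by (simp only: G_def mult.left_commute)
    qed
  qed measurable
  also have "\<dots> = ?n * unit_ball_vol ?n * (\<integral>y. (\<integral>\<mu>. G y \<mu> \<partial>lborel) \<partial>lborel)"
    by (rule integral_mult_right_zero)
  also have "(\<integral>y. (\<integral>\<mu>. G y \<mu> \<partial>lborel) \<partial>lborel) = (\<integral>\<mu>. (\<integral>y. G y \<mu> \<partial>lborel) \<partial>lborel)"
    by (rule lborel_pair.Fubini_integral[OF G_int, symmetric])
  also have "\<dots> = (\<integral>(\<mu>::real). 0 \<partial>lborel)"
  proof (rule Bochner_Integration.integral_cong[OF refl])
    fix \<mu> :: real
    show "(\<integral>y. G y \<mu> \<partial>lborel) = 0"
      unfolding G_def integral_mult_right_zero using zero[of \<mu>] by (auto simp: indicator_def)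
  qed
  finally show ?thesis by simp
qed

text \<open>Averaging the centre over \<open>Q\<close> moves the limit of large scale onto the
  indicator of \<open>Q\<close>: its average \<open>P b\<close> against the rescaled kernel tends to
  the kernel mass times the indicator off the boundary of \<open>Q\<close>. By Fubini the integral
  of g against \<open>P b\<close> is the same for all b \<ge> A, so it equals its limit.\<close>

lemma integral_flux_average_box:
  fixes p q :: 'a
  defines "Q \<equiv> cbox p q"
  assumes r: "0 < r" and Q: "Q \<subseteq> ball 0 (r / 2)" and A: "0 < A"
    and avg: "\<And>b a. A \<le> b \<Longrightarrow> a \<in> Q \<Longrightarrow> (\<integral>y. g y * (b ^ DIM('a) * flux_kernel s (b *\<^sub>R (y - a))) \<partial>lborel) = G a"
    and G [measurable]: "G \<in> borel_measurable borel"
  shows "(\<integral>a. indicator Q a * G a \<partial>lborel) = (\<integral>x. flux_kernel s (x::'a) \<partial>lborel) * (\<integral>y. indicator Q y * g y \<partial>lborel)"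
proof -
  let ?n = "DIM('a)" and ?\<sigma> = "real DIM('a) + 2 * s"
  define \<kappa> where "\<kappa> = (\<integral>x. flux_kernel s (x::'a) \<partial>lborel)"
  note K_int = integrable_flux_kernel[OF s_pos s_less, where 'a='a]
  have \<kappa>: "0 < \<kappa>" unfolding \<kappa>_def by (rule integral_flux_kernel_pos[OF s_pos s_less])
  have [measurable]: "Q \<in> sets borel" by (simp add: Q_def)
  have Q_int: "integrable lborel (\<lambda>a. indicator Q a * c)" for c :: real
    using emeasure_lborel_cbox_finite[of p q] by (intro integrable_mult_left) (simp add: integrable_indicator_iff Q_def)
  obtain C where C: "0 < C" "\<And>x::'a. flux_kernel s x \<le> C * frac_weight s x"
    "\<And>b a (y::'a). 0 < b \<Longrightarrow> flux_kernel s (b *\<^sub>R (y - a)) \<le> C * (1 + norm a + 1 / b) powr ?\<sigma> * frac_weight s y"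
    using flux_kernel_shift_le by blast
  define P where "P b y = (\<integral>a. indicator Q a * (b ^ ?n * flux_kernel s (b *\<^sub>R (y - a))) \<partial>lborel)" for b and y :: 'a
  have P_meas [measurable]: "P b \<in> borel_measurable borel" for b unfolding P_def by measurable
  have swap: "(\<integral>y. g y * P b y \<partial>lborel) = (\<integral>a. indicator Q a * G a \<partial>lborel)" if b: "A \<le> b" for b
  proof -
    have b0: "0 < b" using A b by simp
    let ?F = "\<lambda>a y. indicator Q a * (g y * (b ^ ?n * flux_kernel s (b *\<^sub>R (y - a))))"
    define D where "D = (1 + r / 2 + 1 / b) powr ?\<sigma>"
    have F_int: "integrable (lborel \<Otimes>\<^sub>M lborel) (\<lambda>(a, y). ?F a y)"
    proof (rule Bochner_Integration.integrable_bound)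
      show "integrable (lborel \<Otimes>\<^sub>M lborel) (\<lambda>(a, y). (indicator Q a * (b ^ ?n * (C * D))) * (g y * frac_weight s y))"
        by (intro integrable_times_pair g_int Q_int)
      have "norm (?F a y) \<le> (indicator Q a * (b ^ ?n * (C * D))) * (g y * frac_weight s y)" for a y
      proof (cases "a \<in> Q")
        case True
        then have a: "norm a \<le> r / 2" using Q by auto
        have "flux_kernel s (b *\<^sub>R (y - a)) \<le> C * (1 + norm a + 1 / b) powr ?\<sigma> * frac_weight s y"
          using b0 by (rule C)
        also have "\<dots> \<le> C * D * frac_weight s y"
          unfolding D_def using C a b0 s_pos frac_weight_pos[of s y]
          by (intro mult_left_mono mult_right_mono powr_mono2 add_mono) auto
        finally have "g y * (b ^ ?n * flux_kernel s (b *\<^sub>R (y - a))) \<le> g y * (b ^ ?n * (C * D * frac_weight s y))"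
          using b0 g_nonneg by (intro mult_left_mono) auto
        then show ?thesis using True b0 g_nonneg[of y] flux_nonneg[of "b *\<^sub>R (y - a)"]
          by (simp add: abs_mult abs_of_nonneg mult_ac)
      qed simp
      then show "AE p in lborel \<Otimes>\<^sub>M lborel. norm (case p of (a, y) \<Rightarrow> ?F a y)
          \<le> norm (case p of (a, y) \<Rightarrow> (indicator Q a * (b ^ ?n * (C * D))) * (g y * frac_weight s y))"
        by (intro AE_I2) (auto intro: order_trans[OF _ abs_ge_self] simp del: abs_mult)
    qed measurable
    have "(\<integral>y. g y * P b y \<partial>lborel) = (\<integral>y. (\<integral>a. ?F a y \<partial>lborel) \<partial>lborel)"
      unfolding P_def integral_mult_right_zero[symmetric] by (simp only: mult.left_commute)
    also have "\<dots> = (\<integral>a. (\<integral>y. ?F a y \<partial>lborel) \<partial>lborel)"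
      by (rule lborel_pair.Fubini_integral[OF F_int])
    also have "\<dots> = (\<integral>a. indicator Q a * G a \<partial>lborel)"
      unfolding integral_mult_right_zero
      by (rule Bochner_Integration.integral_cong[OF refl]) (use avg[OF b] in \<open>auto simp: indicator_def\<close>)
    finally show ?thesis .
  qed
  \<comment> \<open>Substituting a = y - u/b moves the scale from the kernel into the indicator,
    leaving the fixed integrable function \<open>flux_kernel s u\<close> as a dominating
    function.\<close>
  have P_eq: "P b y = (\<integral>u. indicator Q (y - (1 / b) *\<^sub>R u) * flux_kernel s u \<partial>lborel)" if b: "0 < b" for b y
  proof -
    have "P b y = (1 / b) ^ ?n * (\<integral>u. indicator Q (y - (1 / b) *\<^sub>R u) * (b ^ ?n * flux_kernel s u) \<partial>lborel)"
      unfolding P_def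
      using lborel_integral_affine[of "\<lambda>a. indicator Q a * (b ^ ?n * flux_kernel s (b *\<^sub>R (y - a)))" "- (1 / b)" y] b
      by simp
    also have "\<dots> = (1 / b) ^ ?n * b ^ ?n * (\<integral>u. indicator Q (y - (1 / b) *\<^sub>R u) * flux_kernel s u \<partial>lborel)"
      by (simp only: mult.left_commute[of _ "b ^ ?n"] integral_mult_right_zero mult.assoc)
    finally show ?thesis using b by (simp add: power_divide)
  qed
  have P_nonneg: "0 \<le> P b y" if "0 < b" for b y
    unfolding P_def using that flux_nonneg by (intro Bochner_Integration.integral_nonneg) auto
  have P_int: "integrable lborel (\<lambda>u. indicator Q (y - c *\<^sub>R u) * flux_kernel s u)" for c y
    by (rule Bochner_Integration.integrable_bound[OF K_int]) (auto simp: indicator_def intro!: AE_I2)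
  have P_le: "P b y \<le> \<kappa>" if b: "0 < b" for b y
    unfolding P_eq[OF b] \<kappa>_def
  proof (rule integral_mono[OF P_int K_int])
    show "indicator Q (y - (1 / b) *\<^sub>R u) * flux_kernel s u \<le> flux_kernel s u" for u
      using flux_nonneg[of u] by (auto simp: indicator_def)
  qed
  \<comment> \<open>If |y| > r and a is in \<open>Q\<close>, then |y| \<le> 2|y - a| and 1 \<le>
    |y|/r, so 1 + |y| \<le> \<open>c0\<close> |y - a|. The first summand of \<open>M\<close> covers
    |y| \<le> r through \<open>P_le\<close>; the second covers |y| > r, where the power b^(-2s) left
    by the scaling is at most A^(-2s).\<close>
  define c0 where "c0 = 2 * (1 + 1 / r)"
  define M where "M = \<kappa> * (1 + r) powr ?\<sigma> + measure lborel Q * (C * c0 powr ?\<sigma> * A powr (- 2 * s))"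
  have c0: "0 < c0" using r by (simp add: c0_def add_pos_pos)
  have P_dom: "P b y \<le> M * frac_weight s y" if b: "A \<le> b" for b y
  proof -
    have b0: "0 < b" using A b by simp
    show ?thesis
    proof (cases "norm y \<le> r")
      case True
      have "1 / 1 powr ?\<sigma> \<le> (1 + r) powr ?\<sigma> / (1 + norm y) powr ?\<sigma>"
        using True r s_pos by (intro inverse_powr_scale_le) (auto intro: add_pos_nonneg)
      then have "1 \<le> (1 + r) powr ?\<sigma> * frac_weight s y" by (simp add: frac_weight_def)
      then have "\<kappa> * 1 \<le> \<kappa> * ((1 + r) powr ?\<sigma> * frac_weight s y)"
        using \<kappa> by (intro mult_left_mono) auto
      also have "\<dots> \<le> M * frac_weight s y"
        unfolding M_def mult.assoc[symmetric] using C frac_weight_pos[of s y]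
        by (intro mult_right_mono) auto
      finally show ?thesis using P_le[OF b0, of y] by simp
    next
      case False
      let ?m = "C * c0 powr ?\<sigma> * A powr (- 2 * s) * frac_weight s y"
      have le: "b ^ ?n * flux_kernel s (b *\<^sub>R (y - a)) \<le> ?m" if a: "a \<in> Q" for a
      proof -
        have "norm a \<le> r / 2" using a Q by auto
        then have "norm y \<le> 2 * norm (y - a)"
          using False norm_triangle_ineq2[of y a] by linarith
        moreover have "1 \<le> (1 / r) * norm y" using False r by (simp add: field_simps)
        moreover have "(1 / r) * norm y \<le> (1 / r) * (2 * norm (y - a))"
          using calculation(1) r by (intro mult_left_mono) auto
        moreover have "c0 * norm (y - a) = 2 * norm (y - a) + (1 / r) * (2 * norm (y - a))"
          by (simp add: c0_def algebra_simps)
        ultimately have "1 + norm y \<le> c0 * norm (y - a)" by linarith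
        also have "\<dots> \<le> (c0 / b) * (1 + b * norm (y - a))"
          using b0 c0 by (simp add: field_simps)
        also have "b * norm (y - a) = norm (b *\<^sub>R (y - a))"
          using b0 by simp
        finally have "frac_weight s (b *\<^sub>R (y - a)) \<le> (c0 / b) powr ?\<sigma> * frac_weight s y"
          unfolding frac_weight_def using b0 c0 s_pos
            inverse_powr_scale_le[of "1 + norm y" "c0 / b" "1 + norm (b *\<^sub>R (y - a))" ?\<sigma>]
          by (simp add: add_pos_nonneg)
        then have "flux_kernel s (b *\<^sub>R (y - a)) \<le> C * ((c0 / b) powr ?\<sigma> * frac_weight s y)"
          using C(1) by (intro order_trans[OF C(2)] mult_left_mono) auto
        then have "b ^ ?n * flux_kernel s (b *\<^sub>R (y - a)) \<le> b ^ ?n * (C * ((c0 / b) powr ?\<sigma> * frac_weight s y))"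
          using b0 by (intro mult_left_mono) auto
        also have "\<dots> = C * (c0 powr ?\<sigma> * b powr (- 2 * s)) * frac_weight s y"
        proof -
          have "b ^ ?n * (c0 / b) powr ?\<sigma> = c0 powr ?\<sigma> * (b powr real ?n / b powr ?\<sigma>)"
            using b0 c0 by (simp add: powr_divide powr_realpow)
          also have "b powr real ?n / b powr ?\<sigma> = b powr (- 2 * s)"
            by (simp add: powr_diff[symmetric])
          finally show ?thesis by (simp add: mult_ac)
        qed
        also have "\<dots> \<le> C * (c0 powr ?\<sigma> * A powr (- 2 * s)) * frac_weight s y"
          using C(1) A b s_pos frac_weight_pos[of s y]
          by (intro mult_right_mono mult_left_mono powr_mono2') auto
        finally show ?thesis by (simp add: mult.assoc)
      qed
      have m0: "0 \<le> ?m" using C(1) frac_weight_pos[of s y] by auto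
      have "P b y \<le> (\<integral>a. indicator Q a * ?m \<partial>lborel)"
        unfolding P_def
      proof (rule Bochner_Integration.integral_mono')
        show "integrable lborel (\<lambda>a. indicator Q a * ?m)" by (rule Q_int)
        show "indicator Q a * (b ^ ?n * flux_kernel s (b *\<^sub>R (y - a))) \<le> indicator Q a * ?m" for a
          using le[of a] by (auto simp: indicator_def)
        show "0 \<le> indicator Q a * ?m" for a
          by (rule mult_nonneg_nonneg[OF _ m0]) simp
      qed
      also have "\<dots> = measure lborel Q * ?m" by simp
      also have "\<dots> \<le> M * frac_weight s y"
        unfolding M_def mult.assoc[symmetric] using \<kappa> frac_weight_pos[of s y]
        by (intro mult_right_mono) (auto simp: mult.assoc)
      finally show ?thesis .
    qed
  qed
  have lim: "(\<lambda>k. \<integral>y. g y * P (A + real k) y \<partial>lborel) \<longlonglongrightarrow> (\<integral>y. g y * (indicator Q y * \<kappa>) \<partial>lborel)"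
  proof (rule integral_dominated_convergence)
    show "integrable lborel (\<lambda>y. M * (g y * frac_weight s y))"
      by (intro integrable_mult_right g_int)
    have "cbox p q - box p q \<in> null_sets lebesgue"
      using negligible_frontier_interval negligible_iff_null_sets by blast
    then have "cbox p q - box p q \<in> null_sets lborel"
      by (subst (asm) null_sets_completion_iff) auto
    then have "AE y in lborel. y \<notin> cbox p q - box p q" by (rule AE_not_in)
    then show "AE y in lborel. (\<lambda>k. g y * P (A + real k) y) \<longlonglongrightarrow> g y * (indicator Q y * \<kappa>)"
    proof eventually_elim
      case (elim y)
      have "(\<lambda>k. \<integral>u. indicator Q (y - (1 / (A + real k)) *\<^sub>R u) * flux_kernel s u \<partial>lborel)
          \<longlonglongrightarrow> (\<integral>u. indicator Q y * flux_kernel s (u::'a) \<partial>lborel)"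
      proof (rule integral_dominated_convergence[OF _ _ K_int])
        show "AE u in lborel. (\<lambda>k. indicator Q (y - (1 / (A + real k)) *\<^sub>R u) * flux_kernel s u)
            \<longlonglongrightarrow> indicator Q y * flux_kernel s u"
        proof (intro AE_I2 tendsto_mult_right)
          fix u :: 'a
          have "(\<lambda>k. 1 / (A + real k)) \<longlonglongrightarrow> 0" by real_asymp
          then have "(\<lambda>k. y - (1 / (A + real k)) *\<^sub>R u) \<longlonglongrightarrow> y - 0 *\<^sub>R u"
            by (intro tendsto_diff tendsto_const tendsto_scaleR)
          then have t: "(\<lambda>k. y - (1 / (A + real k)) *\<^sub>R u) \<longlonglongrightarrow> y" by simp
          show "(\<lambda>k. indicator Q (y - (1 / (A + real k)) *\<^sub>R u) :: real) \<longlonglongrightarrow> indicator Q y"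
          \<comment> \<open>Off the boundary, membership in \<open>Q\<close> is locally constant:
            both the open box and the complement of the closed box are open, so the indicators are
            eventually equal.\<close>
          proof (cases "y \<in> box p q")
            case True
            have "\<forall>\<^sub>F k in sequentially. y - (1 / (A + real k)) *\<^sub>R u \<in> box p q"
              by (rule topological_tendstoD[OF t open_box True])
            then have "\<forall>\<^sub>F k in sequentially. indicator Q (y - (1 / (A + real k)) *\<^sub>R u) = (indicator Q y :: real)"
              by eventually_elim (use True subsetD[OF box_subset_cbox, of _ p q] in \<open>simp add: Q_def\<close>)
            then show ?thesis by (rule tendsto_eventually)
          next
            case False
            with elim have "y \<in> - cbox p q" by auto
            then have "\<forall>\<^sub>F k in sequentially. y - (1 / (A + real k)) *\<^sub>R u \<in> - cbox p q"
              by (intro topological_tendstoD[OF t]) auto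
            then have "\<forall>\<^sub>F k in sequentially. indicator Q (y - (1 / (A + real k)) *\<^sub>R u) = (indicator Q y :: real)"
              by eventually_elim (use \<open>y \<in> - cbox p q\<close> in \<open>auto simp: Q_def\<close>)
            then show ?thesis by (rule tendsto_eventually)
          qed
        qed
        show "AE u in lborel. norm (indicator Q (y - (1 / (A + real k)) *\<^sub>R u) * flux_kernel s u) \<le> flux_kernel s u" for k
          using flux_nonneg by (intro AE_I2) (auto simp: indicator_def)
      qed measurable
      then have "(\<lambda>k. P (A + real k) y) \<longlonglongrightarrow> indicator Q y * \<kappa>"
        using A by (simp add: P_eq \<kappa>_def)
      then show ?case by (rule tendsto_mult_left)
    qed
    show "AE y in lborel. norm (g y * P (A + real k) y) \<le> M * (g y * frac_weight s y)" for k
    proof (rule AE_I2)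
      fix y :: 'a
      have "g y * P (A + real k) y \<le> g y * (M * frac_weight s y)"
        using g_nonneg by (intro mult_left_mono P_dom) auto
      then show "norm (g y * P (A + real k) y) \<le> M * (g y * frac_weight s y)"
        using g_nonneg[of y] P_nonneg[of "A + real k" y] A by (simp add: abs_of_nonneg mult_ac)
    qed
  qed measurable
  have "(\<integral>a. indicator Q a * G a \<partial>lborel) = (\<integral>y. g y * (indicator Q y * \<kappa>) \<partial>lborel)"
    using lim by (simp add: swap LIMSEQ_const_iff)
  also have "\<dots> = (\<integral>y. \<kappa> * (indicator Q y * g y) \<partial>lborel)"
    by (simp only: mult_ac)
  finally show ?thesis by (simp add: \<kappa>_def)
qed

text \<open>At the scale 4/r the average \<open>G a\<close> lies between two multiples of one
  weighted integral, for every centre in the half ball. By \<open>integral_flux_average_box\<close>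
  the box averages of g inherit these bounds up to the kernel mass, and shrinking the boxes gives
  them for g almost everywhere.\<close>

lemma AE_flux_bounds:
  assumes r: "0 < r" and c: "\<And>x::'a. x \<noteq> 0 \<Longrightarrow> c * frac_weight s x \<le> flux_kernel s x" "0 < c"
    and C: "\<And>x::'a. flux_kernel s x \<le> C * frac_weight s x" "0 < C"
    and zero: "\<And>a \<mu>. a \<in> ball 0 (r / 2) \<Longrightarrow> 4 / r \<le> \<mu> \<Longrightarrow> (\<integral>y. g y * bump_lap s (\<mu> *\<^sub>R (y - a)) \<partial>lborel) = 0"
  obtains S where "0 \<le> S" "AE x in lborel. x \<in> ball 0 (r / 2) \<longrightarrow>
    c / 3 powr (real DIM('a) + 2 * s) * S \<le> g x \<and> g x \<le> C * 3 powr (real DIM('a) + 2 * s) * S"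
proof -
  let ?n = "DIM('a)" and ?\<sigma> = "real DIM('a) + 2 * s"
  \<comment> \<open>For |a| < r/2 this gives |A a| < 2, the displacement allowed in
    \<open>frac_weight_comparable\<close>.\<close>
  define A where "A = 4 / r"
  have A: "0 < A" using r by (simp add: A_def)
  define \<kappa> where "\<kappa> = (\<integral>x. flux_kernel s (x::'a) \<partial>lborel)"
  have \<kappa>: "0 < \<kappa>" unfolding \<kappa>_def by (rule integral_flux_kernel_pos[OF s_pos s_less])
  let ?W = "\<lambda>y. g y * (A ^ ?n * frac_weight s (A *\<^sub>R y))"
  define S where "S = (\<integral>y. ?W y \<partial>lborel)"
  have W_int: "integrable lborel ?W"
  proof (rule Bochner_Integration.integrable_bound)
    show "integrable lborel (\<lambda>y. A ^ ?n * (1 + norm (0::'a) + 1 / A) powr ?\<sigma> * (g y * frac_weight s y))"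
      by (intro integrable_mult_right g_int)
    show "AE y in lborel. norm (?W y) \<le> norm (A ^ ?n * (1 + norm (0::'a) + 1 / A) powr ?\<sigma> * (g y * frac_weight s y))"
    proof (rule AE_I2)
      fix y :: 'a
      have "g y * (A ^ ?n * frac_weight s (A *\<^sub>R y)) \<le> g y * (A ^ ?n * ((1 + norm (0::'a) + 1 / A) powr ?\<sigma> * frac_weight s y))"
        using frac_weight_shift[OF s_pos A, of y 0] A g_nonneg by (intro mult_left_mono) auto
      then show "norm (?W y) \<le> norm (A ^ ?n * (1 + norm (0::'a) + 1 / A) powr ?\<sigma> * (g y * frac_weight s y))"
        using A g_nonneg[of y] frac_weight_pos[of s "A *\<^sub>R y"] frac_weight_pos[of s y]
        by (simp add: abs_mult abs_of_pos abs_of_nonneg mult_ac)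
    qed
  qed measurable
  have W_nonneg: "0 \<le> ?W y" for y
    using g_nonneg[of y] A frac_weight_pos[of s "A *\<^sub>R y"] by auto
  have S: "0 \<le> S" unfolding S_def by (rule Bochner_Integration.integral_nonneg[OF W_nonneg])
  define G where "G a = (\<integral>y. g y * (A ^ ?n * flux_kernel s (A *\<^sub>R (y - a))) \<partial>lborel)" for a :: 'a
  have [measurable]: "G \<in> borel_measurable borel" unfolding G_def by measurable
  define l u where "l = c / 3 powr ?\<sigma> * S" and "u = C * 3 powr ?\<sigma> * S"
  have G_bounds: "l \<le> G a" "G a \<le> u" if a: "a \<in> ball 0 (r / 2)" for a
  proof -
    have "A * norm a \<le> 2" using a r by (simp add: A_def field_simps)
    then have near: "norm (A *\<^sub>R (y - a) - A *\<^sub>R y) \<le> 2" "norm (A *\<^sub>R y - A *\<^sub>R (y - a)) \<le> 2" for y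
      using A by (simp_all add: algebra_simps)
    have int: "integrable lborel (\<lambda>y. g y * (A ^ ?n * flux_kernel s (A *\<^sub>R (y - a))))"
      by (rule integrable_flux_average[OF A])
    have "l = (\<integral>y. (c / 3 powr ?\<sigma>) * ?W y \<partial>lborel)" by (simp add: l_def S_def)
    also have "\<dots> \<le> G a"
      unfolding G_def
    proof (rule integral_mono_AE[OF integrable_mult_right[OF W_int] int])
      show "AE y in lborel. (c / 3 powr ?\<sigma>) * ?W y \<le> g y * (A ^ ?n * flux_kernel s (A *\<^sub>R (y - a)))"
        using AE_lborel_singleton[of a]
      proof eventually_elim
        case (elim y)
        have "frac_weight s (A *\<^sub>R y) \<le> 3 powr ?\<sigma> * frac_weight s (A *\<^sub>R (y - a))"
          by (rule frac_weight_comparable[OF s_pos near(2)])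
        then have "c / 3 powr ?\<sigma> * frac_weight s (A *\<^sub>R y) \<le> c * frac_weight s (A *\<^sub>R (y - a))"
          using c(2) by (simp add: field_simps)
        also have "\<dots> \<le> flux_kernel s (A *\<^sub>R (y - a))" using elim A by (intro c) auto
        finally have "g y * (A ^ ?n * (c / 3 powr ?\<sigma> * frac_weight s (A *\<^sub>R y)))
            \<le> g y * (A ^ ?n * flux_kernel s (A *\<^sub>R (y - a)))"
          using A g_nonneg by (intro mult_left_mono) auto
        then show ?case by (simp only: mult_ac)
      qed
    qed
    finally show "l \<le> G a" .
    have "G a \<le> (\<integral>y. (C * 3 powr ?\<sigma>) * ?W y \<partial>lborel)"
      unfolding G_def
    proof (rule integral_mono[OF int integrable_mult_right[OF W_int]])
      fix y
      have "flux_kernel s (A *\<^sub>R (y - a)) \<le> C * frac_weight s (A *\<^sub>R (y - a))" by (rule C)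
      also have "\<dots> \<le> C * (3 powr ?\<sigma> * frac_weight s (A *\<^sub>R y))"
        using C(2) by (intro mult_left_mono frac_weight_comparable[OF s_pos near(1)]) auto
      finally have "g y * (A ^ ?n * flux_kernel s (A *\<^sub>R (y - a)))
          \<le> g y * (A ^ ?n * (C * (3 powr ?\<sigma> * frac_weight s (A *\<^sub>R y))))"
        using A g_nonneg by (intro mult_left_mono) auto
      then show "g y * (A ^ ?n * flux_kernel s (A *\<^sub>R (y - a))) \<le> (C * 3 powr ?\<sigma>) * ?W y"
        by (simp only: mult_ac)
    qed
    also have "\<dots> = u" by (simp add: u_def S_def)
    finally show "G a \<le> u" .
  qed
  have box: "l * measure lborel (cbox p q) \<le> \<kappa> * (\<integral>y. indicator (cbox p q) y * g y \<partial>lborel)"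
      "\<kappa> * (\<integral>y. indicator (cbox p q) y * g y \<partial>lborel) \<le> u * measure lborel (cbox p q)"
    if Q: "cbox p q \<subseteq> ball 0 (r / 2)" for p q
  proof -
    have eq: "(\<integral>a. indicator (cbox p q) a * G a \<partial>lborel) = \<kappa> * (\<integral>y. indicator (cbox p q) y * g y \<partial>lborel)"
      unfolding \<kappa>_def
    proof (rule integral_flux_average_box[OF r Q A])
      fix b a assume "A \<le> b" "a \<in> cbox p q"
      then show "(\<integral>y. g y * (b ^ ?n * flux_kernel s (b *\<^sub>R (y - a))) \<partial>lborel) = G a"
        unfolding G_def using Q by (intro flux_average_const A zero) (auto simp: A_def)
    qed measurable
    have Q_int: "integrable lborel (\<lambda>a. indicator (cbox p q) a * d)" for d :: real
      using emeasure_lborel_cbox_finite[of p q] by (intro integrable_mult_left) (simp add: integrable_indicator_iff)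
    have G_int: "integrable lborel (\<lambda>a. indicator (cbox p q) a * G a)"
    proof (rule Bochner_Integration.integrable_bound[OF Q_int[of "\<bar>l\<bar> + \<bar>u\<bar>"]])
      have [measurable]: "cbox p q \<in> sets borel" by simp
      show "(\<lambda>a. indicator (cbox p q) a * G a) \<in> borel_measurable lborel" by measurable
      have "\<bar>G a\<bar> \<le> \<bar>l\<bar> + \<bar>u\<bar>" if "a \<in> cbox p q" for a
        using G_bounds[of a] that Q by fastforce
      then show "AE a in lborel. norm (indicator (cbox p q) a * G a) \<le> norm (indicator (cbox p q) a * (\<bar>l\<bar> + \<bar>u\<bar>))"
        by (intro AE_I2) (auto simp: indicator_def)
    qed
    have Q_val: "(\<integral>a. indicator (cbox p q) a * d \<partial>lborel) = d * measure lborel (cbox p q)" for d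
      by simp
    have "(\<integral>a. indicator (cbox p q) a * l \<partial>lborel) \<le> (\<integral>a. indicator (cbox p q) a * G a \<partial>lborel)"
      using G_bounds Q by (intro integral_mono[OF Q_int G_int]) (auto simp: indicator_def)
    then show "l * measure lborel (cbox p q) \<le> \<kappa> * (\<integral>y. indicator (cbox p q) y * g y \<partial>lborel)"
      by (simp only: eq Q_val)
    have "(\<integral>a. indicator (cbox p q) a * G a \<partial>lborel) \<le> (\<integral>a. indicator (cbox p q) a * u \<partial>lborel)"
      using G_bounds Q by (intro integral_mono[OF G_int Q_int]) (auto simp: indicator_def)
    then show "\<kappa> * (\<integral>y. indicator (cbox p q) y * g y \<partial>lborel) \<le> u * measure lborel (cbox p q)"
      by (simp only: eq Q_val)
  qed
  \<comment> \<open>g is integrable only against the weight. Cutting it off to the ball gives an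
    integrable function to which Lebesgue differentiation applies.\<close>
  define B where "B = ball (0::'a) (r / 2)"
  have [measurable]: "B \<in> sets borel" by (simp add: B_def)
  let ?gb = "\<lambda>y. indicator B y * g y"
  have gb_int: "integrable lborel ?gb"
  proof (rule Bochner_Integration.integrable_bound[OF integrable_mult_right[OF g_int, of "(1 + r) powr ?\<sigma>"]])
    show "AE y in lborel. norm (?gb y) \<le> norm ((1 + r) powr ?\<sigma> * (g y * frac_weight s y))"
    proof (rule AE_I2)
      fix y :: 'a
      show "norm (?gb y) \<le> norm ((1 + r) powr ?\<sigma> * (g y * frac_weight s y))"
      proof (cases "y \<in> B")
        case True
        then have "norm y \<le> r" using r by (auto simp: B_def)
        then have "1 / 1 powr ?\<sigma> \<le> (1 + r) powr ?\<sigma> / (1 + norm y) powr ?\<sigma>"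
          using r s_pos by (intro inverse_powr_scale_le) (auto intro: add_pos_nonneg)
        then have "g y * 1 \<le> g y * ((1 + r) powr ?\<sigma> * frac_weight s y)"
          using g_nonneg by (intro mult_left_mono) (simp_all add: frac_weight_def)
        then show ?thesis
          using g_nonneg[of y] frac_weight_pos[of s y] True by (simp add: abs_mult abs_of_pos abs_of_nonneg mult_ac)
      qed simp
    qed
  qed measurable
  have "?gb integrable_on cbox a b" for a b
    by (rule integrable_on_subcbox[OF integrable_on_lborel[OF gb_int]]) simp
  \<comment> \<open>Lebesgue differentiation along cubes with lower corner x: outside a null set
    their averages converge to the value at x.\<close>
  from integrable_ccontinuous_explicit[OF this] obtain N where N: "negligible N"
    "\<And>x e. x \<notin> N \<Longrightarrow> 0 < e \<Longrightarrow> \<exists>d>0. \<forall>h. 0 < h \<and> h < d \<longrightarrow>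
      norm (integral (cbox x (x + h *\<^sub>R One)) ?gb /\<^sub>R h ^ ?n - ?gb x) < e"
    by blast
  have bounds: "l / \<kappa> \<le> g x \<and> g x \<le> u / \<kappa>" if x: "x \<in> B" "x \<notin> N" for x
  proof -
    let ?q = "\<lambda>h. integral (cbox x (x + h *\<^sub>R One)) ?gb /\<^sub>R h ^ ?n"
    have "(?q \<longlongrightarrow> ?gb x) (at_right 0)"
    proof (rule tendstoI)
      fix e :: real assume "0 < e"
      from N(2)[OF x(2) this] show "\<forall>\<^sub>F h in at_right 0. dist (?q h) (?gb x) < e"
        unfolding eventually_at_right_field dist_norm by auto
    qed
    then have lim: "(?q \<longlongrightarrow> g x) (at_right 0)" using x by simp
    have ev: "\<forall>\<^sub>F h in at_right 0. l / \<kappa> \<le> ?q h \<and> ?q h \<le> u / \<kappa>"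
    proof -
      obtain e where e: "0 < e" "ball x e \<subseteq> B"
        using openE[OF open_ball, of x 0 "r / 2"] x(1) unfolding B_def by blast
      \<comment> \<open>A cube of side \<open>h\<close> has l1-diameter n h, so
        \<open>h < e / n\<close> keeps it inside the ball of radius \<open>e\<close> about
        x.\<close>
      have "l / \<kappa> \<le> ?q h \<and> ?q h \<le> u / \<kappa>" if h: "0 < h" "h < e / ?n" for h
      proof -
        let ?Q = "cbox x (x + h *\<^sub>R One)"
        have "?Q \<subseteq> ball x e"
        proof
          fix y assume y: "y \<in> ?Q"
          have "norm (y - x) \<le> (\<Sum>i\<in>Basis. \<bar>(y - x) \<bullet> i\<bar>)" by (rule norm_le_l1)
          also have "\<dots> \<le> (\<Sum>i\<in>(Basis::'a set). h)"
            using y by (intro sum_mono) (auto simp: mem_box inner_add_left inner_diff_left)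
          also have "\<dots> < e" using h by (simp add: field_simps)
          finally show "y \<in> ball x e" by (simp add: dist_norm norm_minus_commute)
        qed
        then have QB: "?Q \<subseteq> B" using e by blast
        have "integral ?Q ?gb = (LINT y:?Q|lborel. ?gb y)"
          by (rule set_borel_integral_eq_integral(2)[symmetric])
            (use gb_int in \<open>auto simp: set_integrable_def intro!: integrable_indicator_times\<close>)
        also have "\<dots> = (\<integral>y. indicator ?Q y * g y \<partial>lborel)"
          unfolding set_lebesgue_integral_def using QB
          by (intro Bochner_Integration.integral_cong) (auto simp: indicator_def)
        finally have I: "integral ?Q ?gb = (\<integral>y. indicator ?Q y * g y \<partial>lborel)" .
        have m: "measure lborel ?Q = h ^ ?n"
          using h by (subst content_cbox) (auto simp: inner_add_left)
        show ?thesis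
          using box[OF QB[unfolded B_def]] h \<kappa> unfolding I m
          by (simp add: field_simps)
      qed
      then show ?thesis
        unfolding eventually_at_right_field using e by (intro exI[of _ "e / ?n"]) auto
    qed
    have "l / \<kappa> \<le> g x" using ev by (intro tendsto_lowerbound[OF lim]) (auto elim: eventually_mono)
    moreover have "g x \<le> u / \<kappa>" using ev by (intro tendsto_upperbound[OF lim]) (auto elim: eventually_mono)
    ultimately show ?thesis by simp
  qed
  have "AE x in lebesgue. x \<notin> N"
    using N(1) by (intro AE_not_in) (simp add: negligible_iff_null_sets)
  then have "AE x in lborel. x \<notin> N" by (simp add: AE_completion_iff)
  then have "AE x in lborel. x \<in> ball 0 (r / 2) \<longrightarrow>
    c / 3 powr ?\<sigma> * (S / \<kappa>) \<le> g x \<and> g x \<le> C * 3 powr ?\<sigma> * (S / \<kappa>)"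
    by eventually_elim (use bounds in \<open>auto simp: l_def u_def B_def\<close>)
  \<comment> \<open>The witness is \<open>S\<close> divided by the kernel mass, which is independent
    of the point x.\<close>
  moreover have "0 \<le> S / \<kappa>" using S \<kappa> by simp
  ultimately show ?thesis using that by blast
qed

end

section \<open>Harnack inequality for the essential supremum and infimum\<close>

theorem theorem5p1:
  fixes s :: real
  assumes "0 < s" and "s < 1"
  shows "\<exists>C::real. \<forall>r>0. \<forall>f :: 'a::euclidean_space \<Rightarrow> real.
    (\<forall>x. 0 \<le> f x) \<longrightarrow> weighted_integrable s f \<longrightarrow> frac_laplacian_zero_in s f (ball 0 r) \<longrightarrow>
    esssup (lebesgue_on (ball 0 (r / 2))) (\<lambda>x. ereal (f x))
      \<le> ereal C * essinf (lebesgue_on (ball 0 (r / 2))) (\<lambda>x. ereal (f x))"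
proof -
  let ?\<sigma> = "real DIM('a) + 2 * s"
  obtain C where C: "0 < C" "\<And>x::'a. flux_kernel s x \<le> C * frac_weight s x"
    using flux_kernel_upper[OF assms, where 'a='a] by blast
  obtain c where c: "0 < c" "\<And>x::'a. x \<noteq> 0 \<Longrightarrow> c * frac_weight s x \<le> flux_kernel s x"
    using flux_kernel_lower[OF assms, where 'a='a] by blast
  \<comment> \<open>Both numbers are fixed before \<open>r\<close> and \<open>f\<close> and depend
    only on s and the dimension. The Harnack constant is their ratio, since the common factor
    \<open>S\<close> drops out.\<close>
  define l u where "l = c / 3 powr ?\<sigma>" and "u = C * 3 powr ?\<sigma>"
  have lu: "0 < l" "0 < u" using C c by (simp_all add: l_def u_def)
  have "esssup (lebesgue_on (ball 0 (r / 2))) (\<lambda>x. ereal (f x))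
      \<le> ereal (u / l) * essinf (lebesgue_on (ball 0 (r / 2))) (\<lambda>x. ereal (f x))"
    if r: "0 < r" and nonneg: "\<forall>x. 0 \<le> f x" and wi: "weighted_integrable s f"
      and zero: "frac_laplacian_zero_in s f (ball 0 r)" for r and f :: "'a \<Rightarrow> real"
  proof -
    have f: "f \<in> borel_measurable lebesgue"
      and f_int: "integrable lebesgue (\<lambda>x. f x * frac_weight s x)"
      using wi nonneg by (simp_all add: weighted_integrable_def frac_weight_def abs_of_nonneg)
    obtain g0 where g0: "g0 \<in> borel_measurable lborel" "AE x in lborel. f x = g0 x"
      using completion_ex_borel_measurable_real[OF f] by blast
    \<comment> \<open>Taking the positive part makes the Borel version nonnegative everywhere, and
      it still equals \<open>f\<close> almost everywhere.\<close>
    define g where "g x = max 0 (g0 x)" for x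
    have g [measurable]: "g \<in> borel_measurable borel" using g0(1) unfolding g_def by simp
    have g_nonneg: "0 \<le> g y" for y by (simp add: g_def)
    have "AE x in lborel. f x = g x"
      using g0(2) by eventually_elim (metis g_def max.absorb2 nonneg)
    then have fg: "AE x in lebesgue. f x = g x" by (rule AE_completion)
    have "integrable lebesgue (\<lambda>x. g x * frac_weight s x)"
    proof (rule integrable_cong_AE_imp[OF f_int])
      show "(\<lambda>x. g x * frac_weight s x) \<in> borel_measurable lebesgue"
        by (rule measurable_completion) measurable
      show "AE x in lebesgue. f x * frac_weight s x = g x * frac_weight s x"
        using fg by eventually_elim simp
    qed
    then have g_int: "integrable lborel (\<lambda>x. g x * frac_weight s x)"
      by (subst (asm) integrable_completion) measurable
    have "(\<integral>y. g y * bump_lap s (\<mu> *\<^sub>R (y - a)) \<partial>lborel) = 0"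
      if a: "a \<in> ball 0 (r / 2)" and \<mu>: "4 / r \<le> \<mu>" for a \<mu>
    proof (rule frac_laplacian_zero_in_bump[OF assms zero fg f g])
      have "0 < 4 / r" using r by simp
      with \<mu> show \<mu>0: "0 < \<mu>" by linarith
      \<comment> \<open>The support radius r/4 plus |a| < r/2 stays below r, so the rescaled bump is
        an admissible test function.\<close>
      have "1 / \<mu> \<le> r / 4" using \<mu> \<mu>0 r by (simp add: field_simps)
      show "cball a (1 / \<mu>) \<subseteq> ball 0 r"
      proof
        fix x assume "x \<in> cball a (1 / \<mu>)"
        then have "norm (x - a) \<le> 1 / \<mu>" by (simp add: dist_norm norm_minus_commute)
        moreover have "norm x \<le> norm a + norm (x - a)" by (rule norm_triangle_sub)
        moreover have "norm a < r / 2" using a by simp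
        ultimately have "norm x < r" using \<open>1 / \<mu> \<le> r / 4\<close> r by linarith
        then show "x \<in> ball 0 r" by simp
      qed
    qed
    then obtain S where S: "0 \<le> S"
      "AE x in lborel. x \<in> ball 0 (r / 2) \<longrightarrow> l * S \<le> g x \<and> g x \<le> u * S"
      unfolding l_def u_def
      using AE_flux_bounds[OF assms g g_nonneg g_int r c(2) c(1) C(2) C(1)] by blast
    from fg AE_completion[OF S(2)]
    have "AE x in lebesgue. x \<in> ball 0 (r / 2) \<longrightarrow> l * S \<le> f x \<and> f x \<le> u * S"
      by eventually_elim simp
    then have AE: "AE x in lebesgue_on (ball 0 (r / 2)). l * S \<le> f x \<and> f x \<le> u * S"
      by (subst AE_restrict_space_iff) auto
    have m: "f \<in> borel_measurable (lebesgue_on (ball 0 (r / 2)))"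
      using f by (rule measurable_restrict_space1)
    have up: "esssup (lebesgue_on (ball 0 (r / 2))) (\<lambda>x. ereal (f x)) \<le> ereal (u * S)"
      using AE m by (intro esssup_I) (auto elim: eventually_mono)
    have "esssup (lebesgue_on (ball 0 (r / 2))) (\<lambda>x. - ereal (f x)) \<le> - ereal (l * S)"
      using AE m by (intro esssup_I) (auto elim: eventually_mono)
    then have low: "ereal (l * S) \<le> essinf (lebesgue_on (ball 0 (r / 2))) (\<lambda>x. ereal (f x))"
      unfolding essinf_def by (metis ereal_minus_le_minus ereal_uminus_uminus)
    note up
    also have "ereal (u * S) = ereal (u / l) * ereal (l * S)" using lu by simp
    also have "\<dots> \<le> ereal (u / l) * essinf (lebesgue_on (ball 0 (r / 2))) (\<lambda>x. ereal (f x))"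
      using lu by (intro ereal_mult_left_mono low) auto
    finally show ?thesis .
  qed
  then show ?thesis by blast
qed

end
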